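(* Let $\Gamma$ be an almost rational graph and let $Y:=Y(\Gamma)$ be a negative definite plumbed 3-manifold which is also an integral homology sphere. Then $$\Delta_0(Y)\equiv\tfrac12 \pmod 1,$$ i.e. $\Delta_0(Y)-\frac12\in\mathbb{Z}$, where $0$ denotes the unique $\operatorname{Spin}^c$ structure on $Y$.
   Context: **Plumbed manifolds.** Let $\Gamma$ be a tree with vertices $v_1,\dots,v_s$ and integer weights $w_1,\dots,w_s$. Its linking matrix $M$ is the symmetric $s\times s$ matrix with $M_{ii}=w_i$, $M_{ij}=1$ if $v_i,v_j$ are adjacent and $M_{ij}=0$ otherwise ($i\ne j$). $Y(\Gamma)$ is the closed oriented 3-manifold bounding the 4-dimensional plumbing along $\Gamma$ of disk bundles over $S^2$ with Euler numbers $w_i$. $\Gamma$ and $Y(\Gamma)$ are negative definite if $M$ is. Let $\sigma$ be the signature of $M$ (number of positive minus number of negative eigenvalues), $\pi$ the number of positive eigenvalues, and $\vec\delta=(\deg v_i)_i$. $\operatorname{Spin}^c$ structures on $Y(\Gamma)$ correspond to $(2\mathbb{Z}^s+\vec\delta)/2M\mathbb{Z}^s$; if $Y(\Gamma)$ is an integral homology sphere ($\det M=\pm1$) there is exactly one, denoted $0$, with representative $\vec a=\vec\delta$. **Almost rational graphs (Némethi).** For a negative definite weighted tree with weights $w_i$ and linking matrix $M$, put $\chi(x)=-\frac12\left(\sum_i(-w_i-2)x_i+x^TMx\right)$ for $x\in\mathbb{Z}^s$. The tree is rational if $\chi(x)\ge1$ for every nonzero $x\in\mathbb{Z}_{\ge0}^s$.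 A negative definite weighted tree is almost rational if there is a vertex such that replacing its weight by some smaller-or-equal integer (all other weights unchanged) yields a rational tree. **$\widehat Z_a$.** For $a$ with representative $\vec a\in 2\mathbb{Z}^s+\vec\delta$, $$\widehat Z_a(Y;q)=(-1)^\pi q^{\frac{3\sigma-\operatorname{Tr}M}{4}}\ \mathrm{v.p.}\oint_{|z_1|=1}\!\!\cdots\oint_{|z_s|=1}\prod_{i=1}^s\Big(z_i-\frac1{z_i}\Big)^{2-\deg v_i}\ \sum_{\vec l\in 2M\mathbb{Z}^s+\vec a}q^{-\frac{(\vec l,M^{-1}\vec l)}{4}}\prod_{i=1}^s z_i^{l_i}\ \frac{dz_s}{2\pi i z_s}\cdots\frac{dz_1}{2\pi i z_1},$$ where $q$ is a formal variable, the integral is taken termwise in the sum over $\vec l$, and in each variable $\mathrm{v.p.}\oint_{|z|=1}=\frac12\left[\oint_{|z|=1-\epsilon}+\oint_{|z|=1+\epsilon}\right]$ for small $\epsilon>0$. **$\Delta_a$.** A reduced indexing set for $\widehat Z_a(Y;q)$ is a set $I\subseteq 2M\mathbb{Z}^s+\vec a$ such that $\widehat Z_a(Y;q)=\sum_{\vec\ell\in I}c_{\vec\ell}\,q^{\frac{3\sigma-\operatorname{Tr}M}{4}-\frac{(\vec\ell,M^{-1}\vec\ell)}{4}}$ with all $c_{\vec\ell}\in\mathbb{Q}\setminus\{0\}$ and with pairwise distinct exponents of $q$. Then $\Delta_a=\frac{3\sigma-\operatorname{Tr}M}{4}-\max_{\vec\ell\in I}\frac{(\vec\ell,M^{-1}\vec\ell)}{4}$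 (independent of the choice of $I$; it is defined when $\widehat Z_a(Y;q)\neq0$). *)

theory Defs
  imports
    "HOL-Complex_Analysis.Contour_Integration"
    "Jordan_Normal_Form.Determinant"
    "Jordan_Normal_Form.Char_Poly"
    "Jordan_Normal_Form.Gauss_Jordan_Elimination"
begin

unbundle no inner_syntax
unbundle no vec_syntax

section \<open>Weighted trees\<close>

text \<open>The vertices are \<open>0, \<dots>, nverts \<Gamma> - 1\<close>. An undirected edge is represented by
  both of its orientations.\<close>

record wgraph =
  nverts :: nat
  edges :: "(nat \<times> nat) set"
  weight :: "nat \<Rightarrow> int"

definition has_circuit :: "wgraph \<Rightarrow> bool" where
  "has_circuit \<Gamma> \<longleftrightarrow> (\<exists>p. length p \<ge> 3 \<and> distinct p \<and>
     successively (\<lambda>u v. (u, v) \<in> edges \<Gamma>) p \<and> (last p, hd p) \<in> edges \<Gamma>)"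

definition weighted_tree :: "wgraph \<Rightarrow> bool" where
  "weighted_tree \<Gamma> \<longleftrightarrow>
     nverts \<Gamma> > 0 \<and>
     edges \<Gamma> \<subseteq> {..<nverts \<Gamma>} \<times> {..<nverts \<Gamma>} \<and> sym (edges \<Gamma>) \<and> irrefl (edges \<Gamma>) \<and>
     (\<forall>u<nverts \<Gamma>. \<forall>v<nverts \<Gamma>. (u, v) \<in> (edges \<Gamma>)\<^sup>*) \<and>
     \<not> has_circuit \<Gamma>"

definition deg :: "wgraph \<Rightarrow> nat \<Rightarrow> nat" where
  "deg \<Gamma> v = card {u. (v, u) \<in> edges \<Gamma>}"

definition deg_vec :: "wgraph \<Rightarrow> int vec" where
  "deg_vec \<Gamma> = Matrix.vec (nverts \<Gamma>) (\<lambda>i. int (deg \<Gamma> i))"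

definition linking_matrix :: "wgraph \<Rightarrow> int mat" where
  "linking_matrix \<Gamma> = Matrix.mat (nverts \<Gamma>) (nverts \<Gamma>)
     (\<lambda>(i, j). if i = j then weight \<Gamma> i else if (i, j) \<in> edges \<Gamma> then 1 else 0)"

definition linking_matrix_real :: "wgraph \<Rightarrow> real mat" where
  "linking_matrix_real \<Gamma> = map_mat real_of_int (linking_matrix \<Gamma>)"

definition negative_definite :: "wgraph \<Rightarrow> bool" where
  "negative_definite \<Gamma> \<longleftrightarrow>
     (\<forall>x \<in> carrier_vec (nverts \<Gamma>). x \<noteq> 0\<^sub>v (nverts \<Gamma>) \<longrightarrow>
        x \<bullet> (linking_matrix_real \<Gamma> *\<^sub>v x) < 0)"

text \<open>\<open>H\<^sub>1(Y(\<Gamma>); \<int>)\<close> is the cokernel of the linking matrix.\<close>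

definition integral_homology_sphere :: "wgraph \<Rightarrow> bool" where
  "integral_homology_sphere \<Gamma> \<longleftrightarrow> Determinant.det (linking_matrix \<Gamma>) \<in> {1, -1}"

text \<open>Eigenvalues are counted with multiplicity.\<close>

definition num_pos_eigenvalues :: "real mat \<Rightarrow> nat" where
  "num_pos_eigenvalues A = (\<Sum>r | eigenvalue A r \<and> r > 0. Polynomial.order r (char_poly A))"

definition num_neg_eigenvalues :: "real mat \<Rightarrow> nat" where
  "num_neg_eigenvalues A = (\<Sum>r | eigenvalue A r \<and> r < 0. Polynomial.order r (char_poly A))"

definition signature :: "wgraph \<Rightarrow> int" where
  "signature \<Gamma> = int (num_pos_eigenvalues (linking_matrix_real \<Gamma>))
               - int (num_neg_eigenvalues (linking_matrix_real \<Gamma>))"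

definition mat_trace :: "'a::comm_monoid_add mat \<Rightarrow> 'a" where
  "mat_trace A = (\<Sum>i<dim_row A. A $$ (i, i))"


section \<open>Almost rational graphs\<close>

definition chi :: "wgraph \<Rightarrow> int vec \<Rightarrow> real" where
  "chi \<Gamma> x = - (1/2) * real_of_int
     ((\<Sum>i<nverts \<Gamma>. (- weight \<Gamma> i - 2) * x $ i) + x \<bullet> (linking_matrix \<Gamma> *\<^sub>v x))"

definition rational_graph :: "wgraph \<Rightarrow> bool" where
  "rational_graph \<Gamma> \<longleftrightarrow> weighted_tree \<Gamma> \<and> negative_definite \<Gamma> \<and>
     (\<forall>x \<in> carrier_vec (nverts \<Gamma>). (\<forall>i<nverts \<Gamma>. x $ i \<ge> 0) \<and> x \<noteq> 0\<^sub>v (nverts \<Gamma>) \<longrightarrow>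
        chi \<Gamma> x \<ge> 1)"

definition almost_rational :: "wgraph \<Rightarrow> bool" where
  "almost_rational \<Gamma> \<longleftrightarrow> weighted_tree \<Gamma> \<and> negative_definite \<Gamma> \<and>
     (\<exists>v<nverts \<Gamma>. \<exists>k\<le>weight \<Gamma> v.
        rational_graph (\<Gamma>\<lparr>weight := (weight \<Gamma>)(v := k)\<rparr>))"


section \<open>Principal value integrals\<close>

text \<open>The principal value integral over the unit circle against \<open>dz / (2 \<pi> \<i> z)\<close>. For the
  Laurent-type integrands used here the averaged integral does not depend on small
  \<open>\<epsilon> > 0\<close>, so the limit is the common value.\<close>

definition vp_integral :: "(complex \<Rightarrow> complex) \<Rightarrow> complex" where
  "vp_integral f = Lim (at_right 0) (\<lambda>\<epsilon>.
     (contour_integral (circlepath 0 (1 - \<epsilon>)) (\<lambda>z. f z / (2 * of_real pi * \<i> * z)) +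
      contour_integral (circlepath 0 (1 + \<epsilon>)) (\<lambda>z. f z / (2 * of_real pi * \<i> * z))) / 2)"

text \<open>\<open>vp_iterated n F z\<close> integrates out the variables \<open>0, \<dots>, n - 1\<close> of \<open>F\<close>, the variable
  \<open>n - 1\<close> innermost; the other variables take their values from \<open>z\<close>.\<close>

primrec vp_iterated ::
    "nat \<Rightarrow> ((nat \<Rightarrow> complex) \<Rightarrow> complex) \<Rightarrow> (nat \<Rightarrow> complex) \<Rightarrow> complex" where
  "vp_iterated 0 F z = F z"
| "vp_iterated (Suc n) F z = vp_iterated n (\<lambda>z'. vp_integral (\<lambda>u. F (z'(n := u)))) z"


section \<open>The series \<open>Zhat\<close>\<close>

text \<open>The pairing of \<open>l\<close> with itself under the inverse linking matrix.\<close>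

definition inv_form :: "wgraph \<Rightarrow> int vec \<Rightarrow> real" where
  "inv_form \<Gamma> l = map_vec real_of_int l \<bullet>
     (the (mat_inverse (linking_matrix_real \<Gamma>)) *\<^sub>v map_vec real_of_int l)"

definition shift_exponent :: "wgraph \<Rightarrow> real" where
  "shift_exponent \<Gamma> = real_of_int (3 * signature \<Gamma> - mat_trace (linking_matrix \<Gamma>)) / 4"

definition q_exponent :: "wgraph \<Rightarrow> int vec \<Rightarrow> real" where
  "q_exponent \<Gamma> l = shift_exponent \<Gamma> - inv_form \<Gamma> l / 4"

definition spinc_coset :: "wgraph \<Rightarrow> int vec \<Rightarrow> int vec set" where
  "spinc_coset \<Gamma> a =
     {2 \<cdot>\<^sub>v (linking_matrix \<Gamma> *\<^sub>v x) + a | x. x \<in> carrier_vec (nverts \<Gamma>)}"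

definition Zhat_integrand :: "wgraph \<Rightarrow> int vec \<Rightarrow> (nat \<Rightarrow> complex) \<Rightarrow> complex" where
  "Zhat_integrand \<Gamma> l z =
     (\<Prod>i<nverts \<Gamma>. (z i - 1 / z i) powi (2 - int (deg \<Gamma> i))) * (\<Prod>i<nverts \<Gamma>. z i powi (l $ i))"

definition Zhat_coeff :: "wgraph \<Rightarrow> int vec \<Rightarrow> complex" where
  "Zhat_coeff \<Gamma> l = (-1) ^ num_pos_eigenvalues (linking_matrix_real \<Gamma>) *
     vp_iterated (nverts \<Gamma>) (Zhat_integrand \<Gamma> l) (\<lambda>_. 0)"

text \<open>A formal series in real powers of \<open>q\<close> is represented by its coefficient function.
  \<open>q_series \<Gamma> L c\<close> is the sum of \<open>c l * q ^ q_exponent \<Gamma> l\<close> over \<open>l \<in> L\<close>, with equal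
  powers of \<open>q\<close> collected. For negative definite \<open>\<Gamma>\<close> and \<open>L \<subseteq> \<int>\<^sup>s\<close> only finitely many \<open>l\<close>
  share an exponent, so that each coefficient is a finite sum.\<close>

definition q_series :: "wgraph \<Rightarrow> int vec set \<Rightarrow> (int vec \<Rightarrow> complex) \<Rightarrow> real \<Rightarrow> complex" where
  "q_series \<Gamma> L c = (\<lambda>e. \<Sum>\<^sub>\<infinity>l \<in> {l \<in> L. q_exponent \<Gamma> l = e}. c l)"

definition Zhat :: "wgraph \<Rightarrow> int vec \<Rightarrow> real \<Rightarrow> complex" where
  "Zhat \<Gamma> a = q_series \<Gamma> (spinc_coset \<Gamma> a) (Zhat_coeff \<Gamma>)"


section \<open>The invariant \<open>\<Delta>\<close>\<close>

definition reduced_indexing_set :: "wgraph \<Rightarrow> int vec \<Rightarrow> int vec set \<Rightarrow> bool" where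
  "reduced_indexing_set \<Gamma> a I \<longleftrightarrow> I \<subseteq> spinc_coset \<Gamma> a \<and> inj_on (q_exponent \<Gamma>) I \<and>
     (\<exists>c. (\<forall>l\<in>I. c l \<in> \<rat> - {0}) \<and> Zhat \<Gamma> a = q_series \<Gamma> I c)"

text \<open>The value does not depend on the chosen reduced indexing set. It is meaningful only if
  \<open>Zhat \<Gamma> a\<close> is not the zero series; otherwise \<open>I\<close> is empty and there is no maximum.\<close>

definition Delta :: "wgraph \<Rightarrow> int vec \<Rightarrow> real" where
  "Delta \<Gamma> a = (let I = (SOME I. reduced_indexing_set \<Gamma> a I)
     in shift_exponent \<Gamma> - (GREATEST m. m \<in> (\<lambda>l. inv_form \<Gamma> l / 4) ` I))"

end

theory Submission
  imports
    Defs
    "HOL-Number_Theory.Cong"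
    "HOL-Complex_Analysis.Cauchy_Integral_Theorem"
begin

text \<open>
  Every exponent of \<open>q\<close> that occurs in the series is congruent to \<open>1/2\<close> modulo 1, and
  \<open>\<Delta>\<close> is one of these exponents.

  Write \<open>M\<close> for the linking matrix, \<open>s\<close> for the number of vertices, \<open>w\<close> for the vector of
  weights, \<open>\<delta>\<close> for the vector of degrees and \<open>u\<close> for the vector of ones. Summing the rows
  of \<open>M\<close> gives \<open>M u = w + \<delta>\<close>. As \<open>M\<close> is unimodular, \<open>w = M y\<close> for an integral \<open>y\<close>, hence
  \<open>\<delta> = M (u - y)\<close>, and an element \<open>2 M x + \<delta>\<close> of the coset is \<open>M (2 x + u - y)\<close>. The
  pairing of this element with itself under the inverse of \<open>M\<close> is the value of the form of \<open>M\<close> at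
  \<open>2 x + u - y\<close>, which modulo 4 is
    \<open>u\<^sup>T M u - 2 u\<^sup>T w + y\<^sup>T M y = (Tr M + 2 (s - 1)) - 2 Tr M + y\<^sup>T M y\<close>.
  Here \<open>2 (s - 1)\<close> is the sum of the degrees of a tree (\<open>weighted_tree_sum_deg\<close>). As the
  signature is \<open>- s\<close> (\<open>signature_neg_def\<close>), the claim becomes \<open>y\<^sup>T M y \<equiv> - s (mod 4)\<close>.

  Since \<open>w\<close> is the diagonal of \<open>M\<close>, the vector \<open>y\<close> is characteristic for \<open>M\<close>, and the
  congruence is the reduction modulo 4 of van der Blij's theorem that the square of a
  characteristic vector is congruent to the signature modulo 8. Modulo 4 it is a statement
  about determinants only: \<open>y\<^sup>T M y \<equiv> s + det M - 1\<close> for every symmetric integer matrix of odd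
  determinant (\<open>characteristic_square_mod_4\<close>), where here \<open>det M = (-1)\<^sup>s\<close>. The reason is that
  \<open>M - w w\<^sup>T\<close> has even diagonal and determinant \<open>det M (1 - y\<^sup>T M y)\<close>, while an even symmetric
  matrix of odd determinant is modulo 4 an orthogonal sum of planes of determinant \<open>- 1\<close>.

  That \<open>\<Delta>\<close> is an exponent needs the existence of a reduced indexing set and of the maximum
  in its definition. The first requires that the coefficients of \<open>Zhat\<close> are rational
  (\<open>Zhat_coeff_rational\<close>), that is, that the principal value integrals are, and that only
  finitely many elements of the coset share an exponent, which is definiteness. The second
  holds because the pairings are integers bounded above by 0.
\<close>

section \<open>Even symmetric integer matrices modulo 4\<close>

definition even_symmetric :: "nat \<Rightarrow> int mat \<Rightarrow> bool" where
  "even_symmetric n N \<longleftrightarrow> N \<in> carrier_mat n n \<and> N\<^sup>T = N \<and> (\<forall>i<n. even (N $$ (i, i)))"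

lemma even_symmetric_entry:
  assumes "even_symmetric n N" "i < n" "j < n"
  shows "N $$ (i, j) = N $$ (j, i)"
proof -
  have "N\<^sup>T $$ (i, j) = N $$ (j, i)"
    using assms by (intro index_transpose_mat(1)) (auto simp: even_symmetric_def)
  thus ?thesis using assms(1) by (simp add: even_symmetric_def)
qed

lemma even_sum_symmetric:
  fixes f :: "nat \<Rightarrow> nat \<Rightarrow> int"
  assumes "\<And>k l. k < n \<Longrightarrow> l < n \<Longrightarrow> f k l = f l k" "\<And>k. k < n \<Longrightarrow> even (f k k)"
  shows "even (\<Sum>k<n. \<Sum>l<n. f k l)"
  using assms
proof (induction n)
  case (Suc n)
  have "(\<Sum>k<Suc n. \<Sum>l<Suc n. f k l) =
      (\<Sum>k<n. \<Sum>l<n. f k l) + (\<Sum>k<n. f k n) + (\<Sum>l<n. f n l) + f n n"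
    by (simp add: sum.distrib)
  also have "(\<Sum>l<n. f n l) = (\<Sum>k<n. f k n)"
    using Suc.prems by (intro sum.cong) auto
  finally show ?case using Suc by simp
qed simp

text \<open>Change of coordinates by any integral \<open>P\<close>, square or not, preserves evenness: the new
diagonal entries are values \<open>x\<^sup>T N x\<close>, in which off-diagonal terms pair up.\<close>

lemma even_symmetric_congruence:
  assumes N: "even_symmetric n N" and P: "P \<in> carrier_mat n m"
  shows "even_symmetric m (P\<^sup>T * N * P)"
proof -
  have NC: "N \<in> carrier_mat n n" and NT: "N\<^sup>T = N" using N by (auto simp: even_symmetric_def)
  have "(P\<^sup>T * N * P)\<^sup>T = P\<^sup>T * (P\<^sup>T * N)\<^sup>T"
    using P NC by (intro transpose_mult) auto
  also have "(P\<^sup>T * N)\<^sup>T = N\<^sup>T * P"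
    using P NC by (subst transpose_mult[of _ m n _ n]) auto
  also have "P\<^sup>T * (N\<^sup>T * P) = P\<^sup>T * N * P"
    using P NC NT by (simp add: assoc_mult_mat[of _ m n _ n _ m])
  finally have sym: "(P\<^sup>T * N * P)\<^sup>T = P\<^sup>T * N * P" .
  have "even ((P\<^sup>T * N * P) $$ (i, i))" if i: "i < m" for i
  proof -
    have "(P\<^sup>T * N * P) $$ (i, i) = (\<Sum>l<n. (\<Sum>k<n. P $$ (k, i) * N $$ (k, l)) * P $$ (l, i))"
      using i P NC
      by (subst index_mult_mat(1)) (auto simp: scalar_prod_def lessThan_atLeast0 intro!: sum.cong)
    also have "\<dots> = (\<Sum>l<n. \<Sum>k<n. P $$ (k, i) * N $$ (k, l) * P $$ (l, i))"
      by (simp add: sum_distrib_right)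
    also have "even \<dots>"
      using N even_symmetric_entry[OF N]
      by (intro even_sum_symmetric) (auto simp: even_symmetric_def)
    finally show ?thesis .
  qed
  thus ?thesis using sym P NC by (auto simp: even_symmetric_def)
qed

lemma det_congruence:
  fixes N P :: "'a :: comm_ring_1 mat"
  assumes "N \<in> carrier_mat n n" "P \<in> carrier_mat n n"
  shows "Determinant.det (P\<^sup>T * N * P) = (Determinant.det P)\<^sup>2 * Determinant.det N"
proof -
  have "Determinant.det (P\<^sup>T * N * P) = Determinant.det (P\<^sup>T) * Determinant.det N * Determinant.det P"
    using assms by (simp add: det_mult[of _ n])
  thus ?thesis using det_transpose[OF assms(2)] by (simp add: power2_eq_square)
qed

lemma det_2x2:
  fixes A :: "'a :: comm_ring_1 mat"
  assumes A: "A \<in> carrier_mat 2 2"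
  shows "Determinant.det A = A $$ (0,0) * A $$ (1,1) - A $$ (0,1) * A $$ (1,0)"
  by (subst laplace_expansion_row[OF A, of 0])
     (use A in \<open>auto simp: numeral_2_eq_2 cofactor_def mat_delete_def det_single\<close>)

text \<open>If the first row were even, the determinant would be. The odd entry found there is off the
diagonal and is moved to position \<open>(0, 1)\<close> by a transposition of rows and columns.\<close>

lemma even_symmetric_odd_first_pivot:
  assumes N: "even_symmetric n N" and odd: "odd (Determinant.det N)" and n: "n > 0"
  obtains N' where "even_symmetric n N'" "Determinant.det N' = Determinant.det N" "n \<ge> 2" "odd (N' $$ (0, 1))"
proof -
  have C: "N \<in> carrier_mat n n" using N by (simp add: even_symmetric_def)
  have "\<exists>j<n. odd (N $$ (0, j))"
  proof (rule ccontr)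
    assume "\<not> ?thesis"
    hence "even (Determinant.det N)"
      using n by (subst laplace_expansion_row[OF C n]) (auto intro!: dvd_sum)
    thus False using odd by simp
  qed
  then obtain j where j: "j < n" "odd (N $$ (0, j))" by auto
  have j0: "j \<noteq> 0" using j N by (cases "j = 0") (auto simp: even_symmetric_def)
  have n2: "n \<ge> 2" using j j0 by simp
  show ?thesis
  proof (cases "j = 1")
    case True
    thus ?thesis using that[of N] N n2 j by simp
  next
    case False
    let ?N = "swapcols 1 j (swaprows 1 j N)"
    have "Determinant.det ?N = Determinant.det N"
      using j n2 False C det_swaprows[of 1 n j N] by (subst det_swapcols[of 1 n j]) auto
    moreover have "even_symmetric n ?N"
      using N C j n2 even_symmetric_entry[OF N]
      by (auto simp: even_symmetric_def intro!: eq_matI)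
    moreover have "?N $$ (0, 1) = N $$ (0, j)" using j0 False C j n2 by simp
    ultimately show ?thesis using that[of ?N] n2 j by simp
  qed
qed

text \<open>Splits off the leading \<open>2 \<times> 2\<close> block, of determinant \<open>d\<close>. The complement is scaled by \<open>d\<close>
so that it stays integral; this multiplies the determinant by \<open>d\<^bsup>2m\<^esup>\<close>, which is 1 modulo 4
when \<open>d\<close> is odd.\<close>

lemma det_even_symmetric_pivot:
  assumes N: "even_symmetric (2 + m) N"
  defines "d \<equiv> N $$ (0,0) * N $$ (1,1) - N $$ (0,1) * N $$ (1,0)"
  obtains N' where "even_symmetric m N'" "d ^ (2 * m) * Determinant.det N = d * Determinant.det N'"
proof -
  have NC: "N \<in> carrier_mat (2 + m) (2 + m)" using N by (simp add: even_symmetric_def)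
  define A where "A = Matrix.mat 2 2 (\<lambda>(i,j). N $$ (i,j))"
  define B where "B = Matrix.mat 2 m (\<lambda>(i,j). N $$ (i,2+j))"
  define C where "C = Matrix.mat m 2 (\<lambda>(i,j). N $$ (2+i,j))"
  define D where "D = Matrix.mat m m (\<lambda>(i,j). N $$ (2+i,2+j))"
  have AC: "A \<in> carrier_mat 2 2" and BC: "B \<in> carrier_mat 2 m"
    and CC: "C \<in> carrier_mat m 2" and DC: "D \<in> carrier_mat m m"
    by (auto simp: A_def B_def C_def D_def)
  have N4: "N = four_block_mat A B C D"
    using NC by (intro eq_matI) (auto simp: A_def B_def C_def D_def simp del: add_2_eq_Suc add_2_eq_Suc')
  have d: "d = Determinant.det A" by (subst det_2x2[OF AC]) (auto simp: d_def A_def)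
  \<comment> \<open>The adjugate solves \<open>A X = - d B\<close> over the integers, so \<open>P\<close> clears the block \<open>B\<close>.\<close>
  define X where "X = - (adj_mat A * B)"
  define P where "P = four_block_mat (1\<^sub>m 2) X (0\<^sub>m m 2) (d \<cdot>\<^sub>m 1\<^sub>m m)"
  define S where "S = d \<cdot>\<^sub>m (C * X + d \<cdot>\<^sub>m D)"
  note adj = adj_mat[OF AC]
  have XC: "X \<in> carrier_mat 2 m" using adj BC by (auto simp: X_def)
  have SC: "S \<in> carrier_mat m m" using XC CC DC by (auto simp: S_def)
  have PC: "P \<in> carrier_mat (2 + m) (2 + m)" using XC by (auto simp: P_def)
  have AX: "A * X + d \<cdot>\<^sub>m B = 0\<^sub>m 2 m"
  proof -
    have "A * X = - (A * adj_mat A * B)"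
      using AC adj(1) BC by (simp add: X_def assoc_mult_mat[of _ 2 2 _ 2 _ m])
    also have "\<dots> = - (d \<cdot>\<^sub>m B)" using BC by (simp add: adj d mult_smult_assoc_mat[of _ 2 2 _ m])
    finally show ?thesis using BC by simp
  qed
  have PT: "P\<^sup>T = four_block_mat (1\<^sub>m 2) (0\<^sub>m 2 m) (X\<^sup>T) (d \<cdot>\<^sub>m 1\<^sub>m m)"
    unfolding P_def by (subst transpose_four_block_mat[of _ 2 2 _ m _ m]) (use XC in \<open>auto intro!: eq_matI\<close>)
  have S': "C * X + d \<cdot>\<^sub>m D \<in> carrier_mat m m" using CC XC DC by simp
  have scale: "B * (d \<cdot>\<^sub>m 1\<^sub>m m) = d \<cdot>\<^sub>m B" "D * (d \<cdot>\<^sub>m 1\<^sub>m m) = d \<cdot>\<^sub>m D"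
    "d \<cdot>\<^sub>m 1\<^sub>m m * C = d \<cdot>\<^sub>m C" "d \<cdot>\<^sub>m 1\<^sub>m m * (C * X + d \<cdot>\<^sub>m D) = S"
    using BC DC CC mult_smult_assoc_mat[OF one_carrier_mat S', of d] left_mult_one_mat[OF S']
    by (simp_all add: S_def mult_smult_distrib[of _ _ m _ m] mult_smult_assoc_mat[of _ m m])
  have NP: "N * P = four_block_mat A (0\<^sub>m 2 m) C (C * X + d \<cdot>\<^sub>m D)"
    unfolding N4 P_def
    by (subst mult_four_block_mat[of _ 2 2 _ m _ m _ _ 2 _ m]) (use AC BC CC DC XC AX in \<open>auto simp: scale\<close>)
  have PNP: "P\<^sup>T * N * P = four_block_mat A (0\<^sub>m 2 m) (X\<^sup>T * A + d \<cdot>\<^sub>m C) S"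
  proof -
    have "P\<^sup>T * N * P = P\<^sup>T * (N * P)" using PC NC by (simp add: assoc_mult_mat[of _ "2+m" "2+m" _ "2+m" _ "2+m"])
    also have "\<dots> = four_block_mat A (0\<^sub>m 2 m) (X\<^sup>T * A + d \<cdot>\<^sub>m C) S"
      unfolding NP PT
      by (subst mult_four_block_mat[of _ 2 2 _ m _ m _ _ 2 _ m]) (use AC BC CC DC XC SC in \<open>auto simp: scale\<close>)
    finally show ?thesis .
  qed
  have ES: "even_symmetric (2 + m) (P\<^sup>T * N * P)" by (rule even_symmetric_congruence[OF N PC])
  have S_entry: "S $$ (i, j) = (P\<^sup>T * N * P) $$ (i + 2, j + 2)" if "i < m" "j < m" for i j
    unfolding PNP using that SC AC by auto
  have "even_symmetric m S"
    using ES SC even_symmetric_entry[OF ES] S_entry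
    by (auto simp: even_symmetric_def intro!: eq_matI)
  moreover have "d ^ (2 * m) * Determinant.det N = d * Determinant.det S"
  proof -
    have "Determinant.det P = d ^ m"
      unfolding P_def by (subst det_four_block_mat_lower_left_zero[of _ 2 _ m]) (use XC in auto)
    hence "d ^ (2 * m) * Determinant.det N = Determinant.det (P\<^sup>T * N * P)"
      by (simp add: det_congruence[OF NC PC] power_even_eq)
    also have "\<dots> = d * Determinant.det S"
      unfolding PNP d by (subst det_four_block_mat_upper_right_zero[of _ 2 _ m]) (use AC CC XC SC in auto)
    finally show ?thesis .
  qed
  ultimately show ?thesis using that by blast
qed

lemma odd_square_cong_1_mod_4:
  assumes "odd (x :: int)" shows "[x\<^sup>2 = 1] (mod 4)"
proof -
  from assms obtain k where "x = 2 * k + 1" by (elim oddE)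
  hence "x\<^sup>2 - 1 = 4 * (k * k + k)" by (simp add: power2_eq_square algebra_simps)
  thus ?thesis unfolding cong_iff_dvd_diff by simp
qed

text \<open>A \<open>2 \<times> 2\<close> block with even diagonal and odd off-diagonal entry \<open>b\<close> has determinant
\<open>- b\<^sup>2 \<equiv> - 1 (mod 4)\<close>. Splitting off such blocks until nothing is left gives determinant
\<open>(-1)\<^bsup>n/2\<^esup>\<close>, which is \<open>1 - n\<close> modulo 4 for even \<open>n\<close>.\<close>

theorem det_even_symmetric_mod_4:
  assumes "even_symmetric n N" "odd (Determinant.det N)"
  shows "even n \<and> [Determinant.det N = 1 - int n] (mod 4)"
  using assms
proof (induction n arbitrary: N rule: less_induct)
  case (less n)
  show ?case
  proof (cases "n = 0")
    case True
    thus ?thesis using less.prems by (auto simp: even_symmetric_def)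
  next
    case False
    then obtain M where M: "even_symmetric n M" "Determinant.det M = Determinant.det N" "n \<ge> 2" "odd (M $$ (0, 1))"
      using even_symmetric_odd_first_pivot[OF less.prems] by blast
    define m where "m = n - 2"
    have n: "n = 2 + m" using M by (simp add: m_def)
    define b where "b = M $$ (0,1)"
    have b: "M $$ (1,0) = b" "odd b" using even_symmetric_entry[OF M(1), of 1 0] M n by (auto simp: b_def)
    define d where "d = M $$ (0,0) * M $$ (1,1) - M $$ (0,1) * M $$ (1,0)"
    have dodd: "odd d" and d4: "[d = -1] (mod 4)"
    proof -
      have e: "even (M $$ (0,0))" "even (M $$ (1,1))" using M(1) n by (auto simp: even_symmetric_def)
      then obtain x y where xy: "M $$ (0,0) = 2 * x" "M $$ (1,1) = 2 * y" by (auto elim!: evenE)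
      have "d = 4 * (x * y) - b\<^sup>2" by (simp add: d_def xy b b_def[symmetric] power2_eq_square del: One_nat_def)
      moreover have "[4 * (x * y) - b\<^sup>2 = 0 - 1] (mod 4)"
        by (rule cong_diff) (use odd_square_cong_1_mod_4[OF b(2)] in \<open>auto simp: cong_0_iff\<close>)
      ultimately show "[d = -1] (mod 4)" by simp
      show "odd d" using e b by (simp add: d_def b_def[symmetric] del: One_nat_def)
    qed
    obtain N' where N': "even_symmetric m N'" "d ^ (2 * m) * Determinant.det M = d * Determinant.det N'"
      using det_even_symmetric_pivot[of m M] M(1) unfolding n d_def by blast
    have "odd (d ^ (2 * m) * Determinant.det M)" using dodd less.prems M by simp
    hence "odd (Determinant.det N')" unfolding N' by simp
    hence IH: "even m" "[Determinant.det N' = 1 - int m] (mod 4)"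
      using less.IH[of m N'] N' n by auto
    have "[1 * Determinant.det M = d ^ (2 * m) * Determinant.det M] (mod 4)"
      using odd_square_cong_1_mod_4[of "d ^ m"] dodd
      by (intro cong_mult) (auto simp: power_even_eq cong_sym)
    hence "[Determinant.det N = d * Determinant.det N'] (mod 4)" using N' M by simp
    also have "[d * Determinant.det N' = (-1) * (1 - int m)] (mod 4)" by (intro cong_mult d4 IH)
    also have "[(-1) * (1 - int m) = 1 - int n] (mod 4)"
      using IH(1) by (auto simp: n cong_iff_dvd_diff elim!: evenE)
    finally show ?thesis using IH n by simp
  qed
qed

section \<open>Squares of characteristic vectors modulo 4\<close>

text \<open>Sylvester's determinant identity: both sides are the determinant of the block matrix with
rows \<open>(1, Y)\<close> and \<open>(W, 1)\<close>, reduced to triangular form by multiplication with the same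
unipotent matrix from the right and from the left.\<close>

lemma det_one_minus_mult_swap:
  fixes Y W :: "'a :: idom mat"
  assumes Y: "Y \<in> carrier_mat n m" and W: "W \<in> carrier_mat m n"
  shows "Determinant.det (1\<^sub>m n - Y * W) = Determinant.det (1\<^sub>m m - W * Y)"
proof -
  let ?K = "four_block_mat (1\<^sub>m n) Y W (1\<^sub>m m)"
  let ?L = "four_block_mat (1\<^sub>m n) (0\<^sub>m n m) (- W) (1\<^sub>m m)"
  have K: "?K \<in> carrier_mat (n + m) (n + m)" and L: "?L \<in> carrier_mat (n + m) (n + m)" by auto
  have detL: "Determinant.det ?L = 1"
    by (subst det_four_block_mat_upper_right_zero[of _ n _ m]) (use W in auto)
  have "?K * ?L = four_block_mat (1\<^sub>m n - Y * W) Y (0\<^sub>m m n) (1\<^sub>m m)"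
    by (subst mult_four_block_mat[of _ n n _ m _ m _ _ n _ m])
      (use Y W in \<open>auto intro!: arg_cong2[of _ _ _ _ "\<lambda>A B. four_block_mat A Y B (1\<^sub>m m)"] eq_matI\<close>)
  hence "Determinant.det (?K * ?L) = Determinant.det (1\<^sub>m n - Y * W)"
    by (simp, subst det_four_block_mat_lower_left_zero[of _ n _ m]) (use Y W in auto)
  moreover have "?L * ?K = four_block_mat (1\<^sub>m n) Y (0\<^sub>m m n) (1\<^sub>m m - W * Y)"
    by (subst mult_four_block_mat[of _ n n _ m _ m _ _ n _ m])
      (use Y W in \<open>auto intro!: arg_cong2[of _ _ _ _ "\<lambda>A B. four_block_mat (1\<^sub>m n) Y A B"] eq_matI\<close>)
  hence "Determinant.det (?L * ?K) = Determinant.det (1\<^sub>m m - W * Y)"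
    by (simp, subst det_four_block_mat_lower_left_zero[of _ n _ m]) (use Y W in auto)
  ultimately show ?thesis
    using det_mult[OF K L] det_mult[OF L K] detL by simp
qed

text \<open>The matrix determinant lemma, by the factorization \<open>M - w w\<^sup>T = M (1 - y w\<^sup>T)\<close> and the identity
\<open>det (1 - y w\<^sup>T) = 1 - w\<^sup>T y\<close>.\<close>

lemma det_minus_outer_product:
  fixes M :: "'a :: idom mat"
  assumes M: "M \<in> carrier_mat n n" and y: "y \<in> carrier_vec n" and w: "w \<in> carrier_vec n"
    and Myw: "M *\<^sub>v y = w"
  shows "Determinant.det (M - Matrix.mat n n (\<lambda>(i, j). w $ i * w $ j)) =
    Determinant.det M * (1 - w \<bullet> y)"
proof -
  define Y where "Y = Matrix.mat n 1 (\<lambda>(i, j). y $ i)"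
  define W where "W = Matrix.mat 1 n (\<lambda>(i, j). w $ j)"
  have YC: "Y \<in> carrier_mat n 1" and WC: "W \<in> carrier_mat 1 n" by (auto simp: Y_def W_def)
  have "(M * Y * W) $$ (i, j) = w $ i * w $ j" if ij: "i < n" "j < n" for i j
  proof -
    have "(M * Y) $$ (i, 0) = (M *\<^sub>v y) $ i"
      using ij M y by (auto simp: Y_def scalar_prod_def)
    thus ?thesis using ij M YC WC Myw by (auto simp: scalar_prod_def W_def)
  qed
  hence "Matrix.mat n n (\<lambda>(i, j). w $ i * w $ j) = M * Y * W"
    using M YC WC
    by (intro eq_matI) (auto simp del: index_mult_mat(1) assoc_mult_mat)
  hence "M - Matrix.mat n n (\<lambda>(i, j). w $ i * w $ j) = M * (1\<^sub>m n - Y * W)"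
    using M YC WC by (simp add: mult_minus_distrib_mat[of _ n n _ n] assoc_mult_mat[of _ n n _ 1 _ n])
  hence "Determinant.det (M - Matrix.mat n n (\<lambda>(i, j). w $ i * w $ j)) =
      Determinant.det M * Determinant.det (1\<^sub>m 1 - W * Y)"
    using M YC WC det_one_minus_mult_swap[OF YC WC] det_mult[OF M, of "1\<^sub>m n - Y * W"]
      minus_carrier_mat[OF mult_carrier_mat[OF YC WC], of "1\<^sub>m n"] by simp
  also have "Determinant.det (1\<^sub>m 1 - W * Y) = 1 - w \<bullet> y"
    using y w by (subst det_single) (auto simp: W_def Y_def scalar_prod_def)
  finally show ?thesis .
qed

text \<open>The diagonal becomes \<open>m - m\<^sup>2\<close>, which is even.\<close>

lemma even_symmetric_minus_diag_outer_product:
  assumes "M \<in> carrier_mat n n" "M\<^sup>T = M"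
  shows "even_symmetric n (M - Matrix.mat n n (\<lambda>(i, j). M $$ (i, i) * M $$ (j, j)))"
proof -
  have "M $$ (i, j) = M $$ (j, i)" if "i < n" "j < n" for i j
    using index_transpose_mat(1)[of j M i] assms that by simp
  thus ?thesis using assms by (auto simp: even_symmetric_def intro!: eq_matI)
qed

lemma characteristic_square_mod_4_even_case:
  fixes M :: "int mat"
  assumes M: "M \<in> carrier_mat n n" "M\<^sup>T = M" and odd: "odd (Determinant.det M)"
    and y: "y \<in> carrier_vec n" and My: "M *\<^sub>v y = Matrix.vec n (\<lambda>i. M $$ (i, i))"
    and ev: "even ((M *\<^sub>v y) \<bullet> y)"
  shows "[(M *\<^sub>v y) \<bullet> y = int n + Determinant.det M - 1] (mod 4)"
proof -
  let ?w = "M *\<^sub>v y" and ?d = "Determinant.det M"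
  let ?N = "M - Matrix.mat n n (\<lambda>(i, j). M $$ (i, i) * M $$ (j, j))"
  have "?N = M - Matrix.mat n n (\<lambda>(i, j). ?w $ i * ?w $ j)"
    unfolding My using M by (intro eq_matI) auto
  hence det: "Determinant.det ?N = ?d * (1 - ?w \<bullet> y)"
    using det_minus_outer_product[OF M(1) y _ refl] M y by simp
  have "even n" and c: "[?d * (1 - ?w \<bullet> y) = 1 - int n] (mod 4)"
    using det_even_symmetric_mod_4[OF even_symmetric_minus_diag_outer_product[OF M]] odd ev
    unfolding det by auto
  obtain k where k: "int n = 2 * k" using \<open>even n\<close> by (metis even_of_nat evenE)
  obtain t where t: "?d = 2 * t + 1" using odd by (elim oddE)
  obtain z where z: "?w \<bullet> y = 2 * z" using ev by (elim evenE)
  have "4 dvd (2 * t + 1) * (1 - 2 * z) - (1 - 2 * k)"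
    using c unfolding cong_iff_dvd_diff t z k .
  also have "(2 * t + 1) * (1 - 2 * z) - (1 - 2 * k) = 2 * t - 2 * z + 2 * k - 4 * (t * z)"
    by (simp add: algebra_simps)
  finally have "4 dvd 2 * t - 2 * z + 2 * k" by presburger
  hence "4 dvd 2 * z - (2 * k + (2 * t + 1) - 1)" by presburger
  thus ?thesis unfolding cong_iff_dvd_diff t z k .
qed

text \<open>The square of the characteristic vector \<open>y\<close> modulo 4. If it is even, the matrix
\<open>M - w w\<^sup>T\<close> with \<open>w = M y\<close> has odd determinant and the theorem on even matrices applies. If
it is odd, adding an orthogonal summand \<open>(- 1)\<close> makes it even: the characteristic vector of
the sum is \<open>(y, 1)\<close>, and the size and the determinant change to \<open>n + 1\<close> and \<open>- det M\<close>.\<close>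

theorem characteristic_square_mod_4:
  fixes M :: "int mat"
  assumes M: "M \<in> carrier_mat n n" "M\<^sup>T = M" and odd: "odd (Determinant.det M)"
    and y: "y \<in> carrier_vec n" and My: "M *\<^sub>v y = Matrix.vec n (\<lambda>i. M $$ (i, i))"
  shows "[(M *\<^sub>v y) \<bullet> y = int n + Determinant.det M - 1] (mod 4)"
proof (cases "even ((M *\<^sub>v y) \<bullet> y)")
  case True
  thus ?thesis using characteristic_square_mod_4_even_case[OF assms] by simp
next
  case False
  define E where "E = - (1\<^sub>m 1 :: int mat)"
  define v where "v = Matrix.vec 1 (\<lambda>_. 1 :: int)"
  define M' where "M' = four_block_mat M (0\<^sub>m n 1) (0\<^sub>m 1 n) E"
  define y' where "y' = y @\<^sub>v v"
  have EC: "E \<in> carrier_mat 1 1" and vC: "v \<in> carrier_vec 1" by (auto simp: E_def v_def)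
  have M': "M' \<in> carrier_mat (n + 1) (n + 1)" using M EC by (auto simp: M'_def)
  have y': "y' \<in> carrier_vec (n + 1)" unfolding y'_def using y vC by (rule append_carrier_vec)
  have detE: "Determinant.det E = - 1" by (subst det_single) (auto simp: E_def)
  have det': "Determinant.det M' = - Determinant.det M"
    unfolding M'_def by (subst det_four_block_mat_upper_right_zero[of _ n _ 1]) (use M EC detE in auto)
  have T': "M'\<^sup>T = M'"
    unfolding M'_def by (subst transpose_four_block_mat[of _ n n _ 1 _ 1]) (use M EC in \<open>auto simp: E_def transpose_uminus\<close>)
  have "M' *\<^sub>v y' = (M *\<^sub>v y + 0\<^sub>m n 1 *\<^sub>v v) @\<^sub>v (0\<^sub>m 1 n *\<^sub>v y + E *\<^sub>v v)"
    unfolding M'_def y'_def by (rule four_block_mat_mult_vec) (use M EC y vC in auto)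
  also have "M *\<^sub>v y + 0\<^sub>m n 1 *\<^sub>v v = M *\<^sub>v y" using M y vC by (intro eq_vecI) auto
  also have "0\<^sub>m 1 n *\<^sub>v y + E *\<^sub>v v = - v"
    using y by (intro eq_vecI) (auto simp: E_def v_def scalar_prod_def)
  finally have My': "M' *\<^sub>v y' = (M *\<^sub>v y) @\<^sub>v (- v)" .
  have diag': "M' *\<^sub>v y' = Matrix.vec (n + 1) (\<lambda>i. M' $$ (i, i))"
    unfolding My' My using M by (intro eq_vecI) (auto simp: M'_def v_def E_def)
  have "(M' *\<^sub>v y') \<bullet> y' = (M *\<^sub>v y) \<bullet> y + (- v) \<bullet> v"
    unfolding My' unfolding y'_def by (rule scalar_prod_append) (use M y vC in auto)
  also have "(- v) \<bullet> v = - 1" by (simp add: v_def scalar_prod_def)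
  finally have sq: "(M' *\<^sub>v y') \<bullet> y' = (M *\<^sub>v y) \<bullet> y - 1" by simp
  have "[(M' *\<^sub>v y') \<bullet> y' = int (n + 1) + Determinant.det M' - 1] (mod 4)"
    using False odd by (intro characteristic_square_mod_4_even_case M' T' y' diag') (auto simp: sq det')
  hence "4 dvd (M *\<^sub>v y) \<bullet> y - 1 - (int n + 1 - Determinant.det M - 1)"
    unfolding sq det' cong_iff_dvd_diff by simp
  moreover obtain t where "Determinant.det M = 2 * t + 1" using odd by (elim oddE)
  ultimately have "4 dvd (M *\<^sub>v y) \<bullet> y - (int n + Determinant.det M - 1)" by presburger
  thus ?thesis unfolding cong_iff_dvd_diff .
qed

section \<open>The edges of a tree\<close>

text \<open>The conditions of \<open>weighted_tree\<close> over an arbitrary finite vertex set, because the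
  removal of a leaf does not leave an initial segment of the natural numbers.\<close>

definition tree_on :: "'a set \<Rightarrow> ('a \<times> 'a) set \<Rightarrow> bool" where
  "tree_on V E \<longleftrightarrow> finite V \<and> V \<noteq> {} \<and> E \<subseteq> V \<times> V \<and> sym E \<and> irrefl E \<and>
     (\<forall>u\<in>V. \<forall>v\<in>V. (u, v) \<in> E\<^sup>*) \<and>
     (\<nexists>p. length p \<ge> 3 \<and> distinct p \<and> successively (\<lambda>u v. (u, v) \<in> E) p \<and> (last p, hd p) \<in> E)"

text \<open>The first vertex \<open>v\<close> of a longest path is a leaf. A neighbour of \<open>v\<close> off the path would
extend it, and a neighbour on the path other than the second vertex would close a circuit.\<close>

lemma tree_on_has_leaf:
  assumes T: "tree_on V E" and V: "\<And>r. V \<noteq> {r}"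
  obtains v u where "v \<in> V" "u \<in> V" "v \<noteq> u" "(v, u) \<in> E" "\<And>x. (v, x) \<in> E \<Longrightarrow> x = u"
proof -
  have fin: "finite V" and EV: "E \<subseteq> V \<times> V" and symE: "sym E" and irr: "irrefl E"
    and acyc: "\<And>p. length p \<ge> 3 \<Longrightarrow> distinct p \<Longrightarrow> successively (\<lambda>u v. (u, v) \<in> E) p \<Longrightarrow> (last p, hd p) \<notin> E"
    using T by (auto simp: tree_on_def)
  have flip: "(y, x) \<in> E" if "(x, y) \<in> E" for x y using symE that by (auto dest: symD)
  define path where "path p \<longleftrightarrow> distinct p \<and> successively (\<lambda>u v. (u, v) \<in> E) p \<and> set p \<subseteq> V" for p
  obtain a b where ab: "(a, b) \<in> E"
  proof -
    obtain x where x: "x \<in> V" using T by (auto simp: tree_on_def)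
    obtain y where y: "y \<in> V" "y \<noteq> x"
      using V[of x] x by blast
    have "(x, y) \<in> E\<^sup>*" using T x y by (auto simp: tree_on_def)
    thus ?thesis using y(2) that by (cases rule: converse_rtranclE) auto
  qed
  have "path [a, b]"
    using ab EV irr by (auto simp: path_def irrefl_def)
  moreover have bound: "length p \<le> card V" if "path p" for p
    using that fin by (metis card_mono distinct_card path_def)
  ultimately have "\<exists>p. (path p \<and> length p \<ge> 2) \<and> (\<forall>p'. path p' \<and> length p' \<ge> 2 \<longrightarrow> length p' \<le> length p)"
    by (intro ex_has_greatest_nat[of _ "[a, b]" _ "Suc (card V)"]) (auto simp: less_Suc_eq_le)
  then obtain p where p: "path p" "length p \<ge> 2"
    and max2: "\<And>p'. path p' \<Longrightarrow> length p' \<ge> 2 \<Longrightarrow> length p' \<le> length p"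
    by blast
  have max: "length p' \<le> length p" if "path p'" for p'
    using max2[OF that] p(2) by linarith
  obtain v u q where q: "p = v # u # q" using p(2) by (cases p; cases "tl p") auto
  have vu: "(v, u) \<in> E" "v \<noteq> u" "v \<in> V" "u \<in> V" using p(1) by (auto simp: path_def q)
  have "x = u" if vx: "(v, x) \<in> E" for x
  proof (rule ccontr)
    assume "x \<noteq> u"
    have "x \<in> V" "x \<noteq> v" using vx EV irr by (auto simp: irrefl_def)
    show False
    proof (cases "x \<in> set p")
      case False
      hence "path (x # p)" using p(1) flip[OF vx] \<open>x \<in> V\<close> by (auto simp: path_def q)
      thus False using max[of "x # p"] by simp
    next
      case True
      hence "x \<in> set q" using \<open>x \<noteq> u\<close> \<open>x \<noteq> v\<close> by (simp add: q)
      then obtain q1 q2 where q12: "q = q1 @ x # q2" by (auto simp: in_set_conv_decomp)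
      have "(last (v # u # q1 @ [x]), hd (v # u # q1 @ [x])) \<notin> E"
        using p(1) unfolding path_def q q12
        by (intro acyc) (auto simp: successively_append_iff successively_Cons hd_append split: if_splits)
      thus False using flip[OF vx] by simp
    qed
  qed
  thus ?thesis using that vu by blast
qed

text \<open>Connectedness survives because the retraction that sends the leaf to its neighbour maps
walks to walks.\<close>

lemma tree_on_remove_leaf:
  assumes T: "tree_on V E" and leaf: "v \<in> V" "u \<in> V" "v \<noteq> u" "(v, u) \<in> E" "\<And>x. (v, x) \<in> E \<Longrightarrow> x = u"
  shows "tree_on (V - {v}) (E - {(v, u), (u, v)})"
proof -
  let ?E = "E - {(v, u), (u, v)}"
  have symE: "sym E" and EV: "E \<subseteq> V \<times> V" using T by (auto simp: tree_on_def)
  have flip: "(y, x) \<in> E" if "(x, y) \<in> E" for x y using symE that by (rule symD)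
  define f where "f x = (if x = v then u else x)" for x
  have edge_step: "(f x, f y) \<in> ?E\<^sup>*" if "(x, y) \<in> E" for x y
  proof (cases "x = v \<or> y = v")
    case True
    hence "f x = f y" using that flip[OF that] leaf(3,5) by (auto simp: f_def)
    thus ?thesis by simp
  next
    case False
    thus ?thesis using that by (auto simp: f_def)
  qed
  have walk: "(f x, f y) \<in> ?E\<^sup>*" if "(x, y) \<in> E\<^sup>*" for x y
    using that
  proof induction
    case (step y z)
    show ?case by (rule rtrancl_trans[OF step.IH]) (rule edge_step[OF step.hyps(2)])
  qed simp
  have "(x, y) \<in> ?E\<^sup>*" if "x \<in> V - {v}" "y \<in> V - {v}" for x y
  proof -
    have "(x, y) \<in> E\<^sup>*" using T that by (simp add: tree_on_def)
    thus ?thesis using walk[of x y] that by (simp add: f_def)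
  qed
  moreover have "?E \<subseteq> (V - {v}) \<times> (V - {v})"
  proof
    fix e assume e: "e \<in> ?E"
    obtain x y where xy: "e = (x, y)" by (cases e)
    have "x \<noteq> v" "y \<noteq> v" using e leaf(5) flip[of x y] unfolding xy by auto
    thus "e \<in> (V - {v}) \<times> (V - {v})" using e EV unfolding xy by auto
  qed
  moreover have "sym ?E" using flip by (auto simp: sym_def)
  moreover have "irrefl ?E" using T by (auto simp: tree_on_def irrefl_def)
  moreover have "successively (\<lambda>u v. (u, v) \<in> E) p" if "successively (\<lambda>x y. (x, y) \<in> ?E) p" for p
    using that by (rule successively_mono) auto
  hence "\<nexists>p. length p \<ge> 3 \<and> distinct p \<and> successively (\<lambda>u v. (u, v) \<in> ?E) p \<and> (last p, hd p) \<in> ?E"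
    using T unfolding tree_on_def by blast
  moreover have "finite (V - {v})" "V - {v} \<noteq> {}" using T leaf(2,3) by (auto simp: tree_on_def)
  ultimately show ?thesis unfolding tree_on_def by blast
qed

theorem card_edges_tree_on:
  assumes "tree_on V E"
  shows "card E + 2 = 2 * card V"
  using assms
proof (induction "card V" arbitrary: V E)
  case 0
  thus ?case by (auto simp: tree_on_def)
next
  case (Suc n)
  obtain r where r: "r \<in> V" using Suc.prems by (auto simp: tree_on_def)
  show ?case
  proof (cases "V = {r}")
    case True
    hence "E = {}" using Suc.prems by (auto simp: tree_on_def irrefl_def)
    thus ?thesis using True by simp
  next
    case False
    then obtain v u where leaf: "v \<in> V" "u \<in> V" "v \<noteq> u" "(v, u) \<in> E" "\<And>x. (v, x) \<in> E \<Longrightarrow> x = u"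
      using tree_on_has_leaf[OF Suc.prems] r by (metis singletonD)
    let ?E = "E - {(v, u), (u, v)}"
    have fin: "finite V" "finite E" using Suc.prems finite_subset by (auto simp: tree_on_def)
    have "card ?E + 2 = 2 * card (V - {v})"
      using Suc.hyps leaf(1) fin by (intro Suc.hyps(1) tree_on_remove_leaf Suc.prems leaf) auto
    moreover have "card (V - {v}) + 1 = card V" using card_Suc_Diff1[OF fin(1) leaf(1)] by simp
    moreover have "(u, v) \<in> E" using leaf(4) Suc.prems by (auto simp: tree_on_def dest: symD)
    hence "E = ?E \<union> {(v, u), (u, v)}" using leaf(4) by blast
    hence "card E = card (?E \<union> {(v, u), (u, v)})" by simp
    hence "card E = card ?E + card {(v, u), (u, v)}"
      using fin by (subst (asm) card_Un_disjoint) auto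
    moreover have "card {(v, u), (u, v)} = 2" using leaf(3) by simp
    ultimately show ?thesis by simp
  qed
qed

lemma weighted_tree_sum_deg:
  assumes "weighted_tree \<Gamma>"
  shows "(\<Sum>i<nverts \<Gamma>. deg \<Gamma> i) + 2 = 2 * nverts \<Gamma>"
proof -
  have "tree_on {..<nverts \<Gamma>} (edges \<Gamma>)"
    using assms by (auto simp: weighted_tree_def tree_on_def has_circuit_def)
  moreover have "card (edges \<Gamma>) = (\<Sum>i<nverts \<Gamma>. deg \<Gamma> i)"
  proof -
    have E: "edges \<Gamma> \<subseteq> {..<nverts \<Gamma>} \<times> {..<nverts \<Gamma>}" using assms by (simp add: weighted_tree_def)
    have "edges \<Gamma> = (SIGMA i:{..<nverts \<Gamma>}. {u. (i, u) \<in> edges \<Gamma>})" using E by auto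
    moreover have "finite {u. (i, u) \<in> edges \<Gamma>}" for i
      by (rule finite_subset[of _ "{..<nverts \<Gamma>}"]) (use E in auto)
    ultimately show ?thesis unfolding deg_def by (metis card_SigmaI finite_lessThan)
  qed
  ultimately show ?thesis using card_edges_tree_on by fastforce
qed

section \<open>Signature and determinant of negative definite matrices\<close>

text \<open>The characteristic polynomial factors over the complex numbers, and its roots are real: for
an eigenvector \<open>v\<close> with eigenvalue \<open>a\<close>, both \<open>v\<^sup>* A v = a (v\<^sup>* v)\<close> and \<open>v\<^sup>* v > 0\<close> are
invariant under conjugation.\<close>

lemma real_symmetric_char_poly_splits:
  fixes A :: "real mat"
  assumes A: "A \<in> carrier_mat n n" and sym: "A\<^sup>T = A"
  obtains rs where "char_poly A = (\<Prod>r\<leftarrow>rs. [:- r, 1:])" "length rs = n"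
proof -
  let ?C = "map_mat complex_of_real A"
  have C: "?C \<in> carrier_mat n n" using A by simp
  obtain as where as: "char_poly ?C = (\<Prod>a\<leftarrow>as. [:- a, 1:])" "length as = n"
    using char_poly_factorized[OF C] by blast
  have sym': "A $$ (i, j) = A $$ (j, i)" if "i < n" "j < n" for i j
    using index_transpose_mat(1)[of j A i] that A sym by simp
  have real: "a \<in> \<real>" if "a \<in> set as" for a
  proof -
    have "poly (char_poly ?C) a = 0"
      using that unfolding as by (auto simp: poly_prod_list prod_list_zero_iff)
    hence "eigenvalue ?C a" using eigenvalue_root_char_poly[OF C] by simp
    then obtain v where v: "v \<in> carrier_vec n" "v \<noteq> 0\<^sub>v n" "?C *\<^sub>v v = a \<cdot>\<^sub>v v"
      using A by (auto simp: eigenvalue_def eigenvector_def)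
    have entry: "(\<Sum>j<n. of_real (A $$ (i, j)) * v $ j) = a * v $ i" if "i < n" for i
    proof -
      have "(?C *\<^sub>v v) $ i = (\<Sum>j<n. of_real (A $$ (i, j)) * v $ j)"
        using that A v(1) by (simp add: scalar_prod_def lessThan_atLeast0)
      thus ?thesis using v that by simp
    qed
    define H where "H = (\<Sum>i<n. \<Sum>j<n. cnj (v $ i) * of_real (A $$ (i, j)) * v $ j)"
    define S where "S = (\<Sum>i<n. cnj (v $ i) * v $ i)"
    have "H = (\<Sum>i<n. cnj (v $ i) * (\<Sum>j<n. of_real (A $$ (i, j)) * v $ j))"
      by (simp add: H_def sum_distrib_left mult.assoc)
    also have "\<dots> = (\<Sum>i<n. cnj (v $ i) * (a * v $ i))"
      by (intro sum.cong refl) (simp add: entry)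
    also have "\<dots> = a * S" by (simp add: S_def sum_distrib_left mult_ac)
    finally have HS: "H = a * S" .
    have "cnj H = (\<Sum>i<n. \<Sum>j<n. cnj (v $ j) * of_real (A $$ (j, i)) * v $ i)"
      unfolding H_def cnj_sum
    proof (intro sum.cong refl)
      fix i j assume "i \<in> {..<n}" "j \<in> {..<n}"
      thus "cnj (cnj (v $ i) * of_real (A $$ (i, j)) * v $ j) = cnj (v $ j) * of_real (A $$ (j, i)) * v $ i"
        using sym'[of i j] by (simp add: mult_ac)
    qed
    also have "\<dots> = H" unfolding H_def by (rule sum.swap)
    finally have cH: "cnj H = H" .
    define N where "N = (\<Sum>i<n. (cmod (v $ i))\<^sup>2)"
    have cS: "S = of_real N"
      unfolding S_def N_def of_real_sum by (intro sum.cong refl) (metis complex_norm_square mult.commute)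
    obtain k where k: "k < n" "v $ k \<noteq> 0" using v(1,2) by (metis carrier_vecD eq_vecI index_zero_vec)
    have "N > 0"
      unfolding N_def by (rule sum_pos2[of _ k]) (use k in auto)
    hence "S \<noteq> 0" unfolding cS by simp
    moreover have "cnj S = S" unfolding cS by simp
    ultimately have "cnj a = a" using HS cH by (metis complex_cnj_mult mult_cancel_right)
    thus ?thesis by (simp add: Reals_cnj_iff)
  qed
  interpret poly_of_real: map_poly_inj_idom_hom "of_real :: real \<Rightarrow> complex" ..
  define rs where "rs = map Re as"
  have "map_poly complex_of_real (\<Prod>r\<leftarrow>rs. [:- r, 1:]) = (\<Prod>a\<leftarrow>as. [:- a, 1:])"
    unfolding poly_of_real.hom_prod_list rs_def map_map
    using real by (intro arg_cong[of _ _ prod_list] map_cong refl) (simp add: map_poly_pCons)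
  also have "\<dots> = map_poly complex_of_real (char_poly A)"
    unfolding as(1)[symmetric] by (rule of_real_hom.char_poly_hom[OF A])
  finally have "char_poly A = (\<Prod>r\<leftarrow>rs. [:- r, 1:])" by (metis poly_of_real.eq_iff)
  moreover have "length rs = n" by (simp add: rs_def as)
  ultimately show ?thesis using that by blast
qed

lemma order_prod_linear_factors:
  "Polynomial.order r (\<Prod>a\<leftarrow>rs. [:- a, 1:]) = count_list rs (r :: 'a :: field)"
proof (induction rs)
  case (Cons a rs)
  have "Polynomial.order r (\<Prod>a\<leftarrow>a # rs. [:- a, 1:]) =
      Polynomial.order r [:- a, 1:] + Polynomial.order r (\<Prod>a\<leftarrow>rs. [:- a, 1:])"
    by (simp only: list.map prod_list.Cons, rule order_mult)
       (auto simp: prod_list_zero_iff simp del: mult_pCons_left)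
  thus ?case using Cons by (simp add: order_linear')
qed simp

context
  fixes A :: "real mat" and n :: nat
  assumes A: "A \<in> carrier_mat n n" and sym: "A\<^sup>T = A"
    and neg: "\<And>x. x \<in> carrier_vec n \<Longrightarrow> x \<noteq> 0\<^sub>v n \<Longrightarrow> x \<bullet> (A *\<^sub>v x) < 0"
begin

lemma neg_def_eigenvalue_neg: "eigenvalue A r \<Longrightarrow> r < 0"
proof -
  assume "eigenvalue A r"
  then obtain v where v: "v \<in> carrier_vec n" "v \<noteq> 0\<^sub>v n" "A *\<^sub>v v = r \<cdot>\<^sub>v v"
    using A by (auto simp: eigenvalue_def eigenvector_def)
  have "r * (v \<bullet> v) < 0" using neg[OF v(1,2)] v by simp
  moreover have "v \<bullet> v \<ge> 0" by (auto simp: scalar_prod_def intro: sum_nonneg)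
  ultimately show "r < 0" by (simp add: mult_less_0_iff)
qed

lemma neg_def_num_pos_eigenvalues: "num_pos_eigenvalues A = 0"
proof -
  have "{r. eigenvalue A r \<and> r > 0} = {}" using neg_def_eigenvalue_neg by fastforce
  thus ?thesis unfolding num_pos_eigenvalues_def by (simp only: sum.empty)
qed

lemma neg_def_num_neg_eigenvalues: "num_neg_eigenvalues A = n"
proof -
  obtain rs where rs: "char_poly A = (\<Prod>r\<leftarrow>rs. [:- r, 1:])" "length rs = n"
    using real_symmetric_char_poly_splits[OF A sym] .
  have "eigenvalue A r \<longleftrightarrow> r \<in> set rs" for r
    unfolding eigenvalue_root_char_poly[OF A] rs by (auto simp: poly_prod_list prod_list_zero_iff)
  hence "{r. eigenvalue A r \<and> r < 0} = set rs" using neg_def_eigenvalue_neg by auto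
  thus ?thesis
    unfolding num_neg_eigenvalues_def rs order_prod_linear_factors by (simp add: sum_count_set rs)
qed

text \<open>\<open>(-1)\<^sup>n det A\<close> is the value at 0 of the characteristic polynomial, a product of factors
\<open>- r\<close> with \<open>r < 0\<close>.\<close>

lemma neg_def_det_sign: "(-1) ^ n * Determinant.det A > 0"
proof -
  obtain rs where rs: "char_poly A = (\<Prod>r\<leftarrow>rs. [:- r, 1:])" "length rs = n"
    using real_symmetric_char_poly_splits[OF A sym] .
  have "r < 0" if "r \<in> set rs" for r
    using that by (intro neg_def_eigenvalue_neg)
      (auto simp: eigenvalue_root_char_poly[OF A] rs poly_prod_list prod_list_zero_iff)
  hence "poly (\<Prod>r\<leftarrow>rs. [:- r, 1:]) 0 > 0"
    by (induction rs) (auto simp: mult_neg_pos)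
  moreover have "poly (char_poly A) 0 = Determinant.det (- A)"
  proof -
    have "char_matrix A 0 = A" using A by (intro eq_matI) (auto simp: char_matrix_def)
    thus ?thesis unfolding char_poly_matrix[OF A] by simp
  qed
  moreover have "- A = (-1) \<cdot>\<^sub>m A" by (intro eq_matI) auto
  ultimately show ?thesis unfolding rs using A by (simp add: det_smult)
qed

end

lemma linking_matrix_carrier [simp]:
  "linking_matrix \<Gamma> \<in> carrier_mat (nverts \<Gamma>) (nverts \<Gamma>)"
  "linking_matrix_real \<Gamma> \<in> carrier_mat (nverts \<Gamma>) (nverts \<Gamma>)"
  by (auto simp: linking_matrix_def linking_matrix_real_def)

lemma linking_matrix_symmetric:
  assumes "weighted_tree \<Gamma>"
  shows "(linking_matrix \<Gamma>)\<^sup>T = linking_matrix \<Gamma>" "(linking_matrix_real \<Gamma>)\<^sup>T = linking_matrix_real \<Gamma>"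
  using assms by (auto simp: weighted_tree_def linking_matrix_def linking_matrix_real_def dest: symD intro!: eq_matI)

lemma signature_neg_def:
  assumes "weighted_tree \<Gamma>" "negative_definite \<Gamma>"
  shows "signature \<Gamma> = - int (nverts \<Gamma>)"
  using assms neg_def_num_pos_eigenvalues[of "linking_matrix_real \<Gamma>" "nverts \<Gamma>"]
    neg_def_num_neg_eigenvalues[of "linking_matrix_real \<Gamma>" "nverts \<Gamma>"]
  by (auto simp: signature_def negative_definite_def linking_matrix_symmetric)

lemma det_linking_matrix_neg_def:
  assumes "weighted_tree \<Gamma>" "negative_definite \<Gamma>" "integral_homology_sphere \<Gamma>"
  shows "Determinant.det (linking_matrix \<Gamma>) = (-1) ^ nverts \<Gamma>"
proof -
  have "(-1) ^ nverts \<Gamma> * Determinant.det (linking_matrix_real \<Gamma>) > 0"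
    using assms by (intro neg_def_det_sign) (auto simp: negative_definite_def linking_matrix_symmetric)
  also have "Determinant.det (linking_matrix_real \<Gamma>) = of_int (Determinant.det (linking_matrix \<Gamma>))"
    unfolding linking_matrix_real_def by (rule of_int_hom.hom_det)
  finally have "(-1) ^ nverts \<Gamma> * Determinant.det (linking_matrix \<Gamma>) > 0"
    by (metis (mono_tags, opaque_lifting) of_int_0_less_iff of_int_1 of_int_minus of_int_mult of_int_power)
  thus ?thesis using assms(3)
    by (cases "even (nverts \<Gamma>)") (auto simp: integral_homology_sphere_def)
qed

section \<open>Rationality of the coefficients\<close>

definition circle_mean :: "real \<Rightarrow> (complex \<Rightarrow> complex) \<Rightarrow> complex" where
  "circle_mean r f = contour_integral (circlepath 0 r) (\<lambda>z. f z / (2 * of_real pi * \<i> * z))"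

text \<open>The part of the integrand that depends on the variable of one vertex, with
  \<open>p = 2 - deg v\<close>.\<close>

definition vertex_factor :: "int \<Rightarrow> int \<Rightarrow> complex \<Rightarrow> complex" where
  "vertex_factor p l z = (z - 1 / z) powi p * z powi l"

lemma off_unit_circle_nonzero:
  assumes "cmod z = r" "0 < r" "r \<noteq> 1"
  shows "z \<noteq> 0" "z\<^sup>2 - 1 \<noteq> 0" "z - 1 / z \<noteq> 0"
proof -
  show z: "z \<noteq> 0" using assms by auto
  show sq: "z\<^sup>2 - 1 \<noteq> 0"
  proof
    assume "z\<^sup>2 - 1 = 0"
    hence "cmod (z\<^sup>2) = 1" by simp
    hence "(cmod z)\<^sup>2 = 1" by (simp add: norm_power)
    thus False using assms by (auto simp: power2_eq_1_iff)
  qed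
  have "z * (z - 1 / z) = z\<^sup>2 - 1" using z by (simp add: algebra_simps power2_eq_square)
  thus "z - 1 / z \<noteq> 0" using sq by auto
qed

lemma vertex_factor_integrable:
  assumes "0 < r" "r \<noteq> 1"
  shows "(\<lambda>z. vertex_factor p l z / (2 * of_real pi * \<i> * z)) contour_integrable_on circlepath 0 r"
proof (rule contour_integrable_continuous_circlepath)
  show "continuous_on (path_image (circlepath 0 r)) (\<lambda>z. vertex_factor p l z / (2 * of_real pi * \<i> * z))"
    unfolding vertex_factor_def
    using off_unit_circle_nonzero[OF _ assms] assms
    by (intro continuous_intros) (auto simp: path_image_circlepath)
qed

text \<open>Multiplication by \<open>z - 1/z\<close> shifts the power of \<open>z\<close> up and down by one. Inside the
unit circle this recurrence reduces all means to those with \<open>p = 0\<close> and, for negative \<open>p\<close>,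
to vanishing ones.\<close>

lemma circle_mean_vertex_factor_rec:
  assumes "0 < r" "r \<noteq> 1"
  shows "circle_mean r (vertex_factor (p + 1) l) =
    circle_mean r (vertex_factor p (l + 1)) - circle_mean r (vertex_factor p (l - 1))"
proof -
  have "vertex_factor (p + 1) l z = vertex_factor p (l + 1) z - vertex_factor p (l - 1) z"
    if "cmod z = r" for z
    using off_unit_circle_nonzero[OF that assms]
    by (simp add: vertex_factor_def power_int_add power_int_diff algebra_simps)
  hence "circle_mean r (vertex_factor (p + 1) l) =
      contour_integral (circlepath 0 r) (\<lambda>z. vertex_factor p (l + 1) z / (2 * of_real pi * \<i> * z) -
        vertex_factor p (l - 1) z / (2 * of_real pi * \<i> * z))"
    unfolding circle_mean_def using assms
    by (intro contour_integral_eq) (auto simp: path_image_circlepath diff_divide_distrib)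
  also have "\<dots> = circle_mean r (vertex_factor p (l + 1)) - circle_mean r (vertex_factor p (l - 1))"
    unfolding circle_mean_def by (intro contour_integral_diff vertex_factor_integrable assms)
  finally show ?thesis .
qed

lemma circle_mean_power:
  assumes "0 < r"
  shows "circle_mean r (vertex_factor 0 l) = (if l = 0 then 1 else 0)"
proof (cases "l = 0")
  case True
  have "circle_mean r (vertex_factor 0 0) =
      contour_integral (circlepath 0 r) (\<lambda>z. (1 / (2 * of_real pi * \<i>)) * (1 / (z - 0)))"
    by (simp add: circle_mean_def vertex_factor_def)
  also have "\<dots> = (1 / (2 * of_real pi * \<i>)) * contour_integral (circlepath 0 r) (\<lambda>z. 1 / (z - 0))"
    by (rule contour_integral_lmul, rule contour_integrable_continuous_circlepath)
      (use assms in \<open>auto intro!: continuous_intros simp: path_image_circlepath\<close>)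
  also have "\<dots> = 1" by (subst contour_integral_circlepath[OF assms]) simp
  finally show ?thesis using True by simp
next
  case False
  have "((\<lambda>z. vertex_factor 0 l z / (2 * of_real pi * \<i> * z)) has_contour_integral 0) (circlepath 0 r)"
  proof (rule Cauchy_theorem_primitive)
    show "((\<lambda>z. z powi l / (2 * of_real pi * \<i> * of_int l)) has_field_derivative
        vertex_factor 0 l z / (2 * of_real pi * \<i> * z)) (at z within - {0})" if "z \<in> - {0}" for z
      using that False
      by (auto intro!: derivative_eq_intros simp: vertex_factor_def power_int_diff field_simps)
  qed (use assms in \<open>auto simp: path_image_circlepath\<close>)
  thus ?thesis using False by (simp add: circle_mean_def contour_integral_unique)
qed

text \<open>For \<open>l > p\<close> the integrand is, up to a constant, \<open>(z\<^sup>2 - 1)\<^sup>p z\<^bsup>l-p-1\<^esup>\<close>, which is holomorphic in the open unit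
disc.\<close>

lemma circle_mean_vertex_factor_zero:
  assumes r: "0 < r" "r < 1" and l: "l \<ge> p + 1"
  shows "circle_mean r (vertex_factor p l) = 0"
proof -
  have nz: "z\<^sup>2 \<noteq> 1" if "cmod z < 1" for z
  proof
    assume "z\<^sup>2 = 1"
    hence "(cmod z)\<^sup>2 = 1" by (metis norm_one norm_power)
    thus False using that norm_ge_zero[of z] by (auto simp: power2_eq_1_iff)
  qed
  have "((\<lambda>z. (z\<^sup>2 - 1) powi p * z powi (l - p - 1) / (2 * of_real pi * \<i>)) has_contour_integral 0) (circlepath 0 r)"
    using r l nz
    by (intro Cauchy_theorem_disc_simple[of _ 0 1] holomorphic_intros)
       (auto simp: path_image_circlepath)
  hence "((\<lambda>z. vertex_factor p l z / (2 * of_real pi * \<i> * z)) has_contour_integral 0) (circlepath 0 r)"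
  proof (rule has_contour_integral_eq)
    fix z assume "z \<in> path_image (circlepath 0 r)"
    hence "cmod z = r" using r by (simp add: path_image_circlepath)
    hence z: "z \<noteq> 0" using r by auto
    hence "z - 1 / z = (z\<^sup>2 - 1) / z" by (simp add: field_simps power2_eq_square)
    thus "(z\<^sup>2 - 1) powi p * z powi (l - p - 1) / (2 * of_real pi * \<i>) =
        vertex_factor p l z / (2 * of_real pi * \<i> * z)"
      using z by (simp add: vertex_factor_def power_int_divide_distrib power_int_diff)
  qed
  thus ?thesis by (simp add: circle_mean_def contour_integral_unique)
qed

lemma circle_mean_vertex_factor_inside:
  "\<exists>q\<in>\<rat>. \<forall>r\<in>{0<..<1}. circle_mean r (vertex_factor p l) = q"
proof (induction p arbitrary: l rule: int_induct[where k = 0])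
  case base
  have "\<forall>r\<in>{0<..<1}. circle_mean r (vertex_factor 0 l) = (if l = 0 then 1 else 0)"
    using circle_mean_power by simp
  thus ?case by (intro bexI[of _ "if l = 0 then 1 else 0"]) auto
next
  case (step1 p)
  obtain q1 where q1: "q1 \<in> \<rat>" "\<forall>r\<in>{0<..<1}. circle_mean r (vertex_factor p (l + 1)) = q1"
    using step1.IH by blast
  obtain q2 where q2: "q2 \<in> \<rat>" "\<forall>r\<in>{0<..<1}. circle_mean r (vertex_factor p (l - 1)) = q2"
    using step1.IH by blast
  show ?case
    using q1 q2 circle_mean_vertex_factor_rec[of _ p l] by (intro bexI[of _ "q1 - q2"]) auto
next
  \<comment> \<open>Downwards in \<open>p\<close> the recurrence is solved for the mean with the smaller power \<open>l\<close>, by induction on the distance from the range \<open>l > p - 1\<close> where the mean vanishes.\<close>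
  case (step2 p)
  have "\<exists>q\<in>\<rat>. \<forall>r\<in>{0<..<1}. circle_mean r (vertex_factor (p - 1) l) = q"
    if "l \<ge> p - int k" for k l
    using that
  proof (induction k arbitrary: l)
    case 0
    hence "\<forall>r\<in>{0<..<1}. circle_mean r (vertex_factor (p - 1) l) = 0"
      using circle_mean_vertex_factor_zero by auto
    thus ?case by (intro bexI[of _ 0]) auto
  next
    case (Suc k)
    obtain q1 where q1: "q1 \<in> \<rat>" "\<forall>r\<in>{0<..<1}. circle_mean r (vertex_factor (p - 1) (l + 2)) = q1"
      using Suc.IH[of "l + 2"] Suc.prems by auto
    obtain q2 where q2: "q2 \<in> \<rat>" "\<forall>r\<in>{0<..<1}. circle_mean r (vertex_factor p (l + 1)) = q2"
      using step2.IH by blast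
    show ?case
      using q1 q2 circle_mean_vertex_factor_rec[of _ "p - 1" "l + 1"]
      by (intro bexI[of _ "q1 - q2"]) (auto simp: add.assoc)
  qed
  from this[of "nat (p - l)"] show ?case by auto
qed

lemma circle_mean_altdef:
  assumes "r \<noteq> 0"
  shows "circle_mean r f = integral {0..1} (\<lambda>t. f (of_real r * exp (2 * of_real pi * \<i> * of_real t)))"
  unfolding circle_mean_def contour_integral_integral
  using assms by (intro integral_cong, simp only: vector_derivative_circlepath) (auto simp: circlepath)

text \<open>Inversion in the unit circle, \<open>z \<mapsto> 1 / cnj z\<close>, keeps the direction in which circles are
traversed, and the factor has real coefficients. Thus the means outside the unit circle follow from
those inside.\<close>

lemma circle_mean_vertex_factor_inversion:
  assumes "r > 0"
  shows "circle_mean r (vertex_factor p l) = cnj ((- 1) powi p * circle_mean (1 / r) (vertex_factor p (- l)))"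
proof -
  let ?e = "\<lambda>t. exp (2 * of_real pi * \<i> * of_real t) :: complex"
  have "vertex_factor p l (of_real r * ?e t) =
      cnj ((- 1) powi p * vertex_factor p (- l) (of_real (1 / r) * ?e t))" for t
  proof -
    define w where "w = of_real (1 / r) * ?e t"
    have w: "w \<noteq> 0" using assms by (simp add: w_def)
    have "cnj (?e t) = inverse (?e t)" by (simp add: exp_cnj exp_minus)
    hence inv: "of_real r * ?e t = cnj (1 / w)" using assms by (simp add: w_def field_simps)
    have "1 / w - 1 / (1 / w) = - 1 * (w - 1 / w)" by simp
    hence "vertex_factor p l (1 / w) = (- 1) powi p * vertex_factor p (- l) w"
      unfolding vertex_factor_def
      by (simp only: power_int_mult_distrib) (use w in \<open>simp add: power_int_divide_distrib power_int_minus field_simps\<close>)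
    moreover have "vertex_factor p l (cnj (1 / w)) = cnj (vertex_factor p l (1 / w))"
      by (simp add: vertex_factor_def)
    ultimately show ?thesis unfolding inv w_def[symmetric] by (simp only:)
  qed
  hence "circle_mean r (vertex_factor p l) =
      integral {0..1} (\<lambda>t. cnj ((- 1) powi p * vertex_factor p (- l) (of_real (1 / r) * ?e t)))"
    using assms by (subst circle_mean_altdef) auto
  also have "\<dots> = cnj (integral {0..1} (\<lambda>t. (- 1) powi p * vertex_factor p (- l) (of_real (1 / r) * ?e t)))"
    by (rule integral_cnj[symmetric])
  also have "\<dots> = cnj ((- 1) powi p * circle_mean (1 / r) (vertex_factor p (- l)))"
    using assms by (subst circle_mean_altdef) auto
  finally show ?thesis .
qed

lemma circle_mean_vertex_factor_outside:
  "\<exists>q\<in>\<rat>. \<forall>r>1. circle_mean r (vertex_factor p l) = q"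
proof -
  obtain q where q: "q \<in> \<rat>" "\<forall>r\<in>{0<..<1}. circle_mean r (vertex_factor p (- l)) = q"
    using circle_mean_vertex_factor_inside by blast
  have "cnj ((- 1) powi p * q) = (- 1) powi p * q"
    using q(1) by (auto elim!: Rats_cases')
  hence "\<forall>r>1. circle_mean r (vertex_factor p l) = (- 1) powi p * q"
    using q(2) circle_mean_vertex_factor_inversion[of _ p l] by simp
  moreover have "(- 1) powi p * q \<in> \<rat>" using q(1) by (cases "even p") auto
  ultimately show ?thesis by blast
qed

text \<open>Unlike \<open>vp_integral\<close>, which has a value for every function, this predicate includes the
existence of the contour integrals, so that constants may be pulled out even when they are 0.\<close>

definition has_vp_integral :: "(complex \<Rightarrow> complex) \<Rightarrow> complex \<Rightarrow> bool" where
  "has_vp_integral f q \<longleftrightarrow> (\<forall>\<^sub>F \<epsilon> in at_right 0. \<exists>a b.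
     ((\<lambda>z. f z / (2 * of_real pi * \<i> * z)) has_contour_integral a) (circlepath 0 (1 - \<epsilon>)) \<and>
     ((\<lambda>z. f z / (2 * of_real pi * \<i> * z)) has_contour_integral b) (circlepath 0 (1 + \<epsilon>)) \<and>
     (a + b) / 2 = q)"

lemma vp_integral_unique:
  assumes "has_vp_integral f q"
  shows "vp_integral f = q"
proof -
  have "\<forall>\<^sub>F \<epsilon> in at_right 0.
     (contour_integral (circlepath 0 (1 - \<epsilon>)) (\<lambda>z. f z / (2 * of_real pi * \<i> * z)) +
      contour_integral (circlepath 0 (1 + \<epsilon>)) (\<lambda>z. f z / (2 * of_real pi * \<i> * z))) / 2 = q"
    using assms unfolding has_vp_integral_def
    by (rule eventually_mono) (auto dest!: contour_integral_unique)
  thus ?thesis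
    unfolding vp_integral_def by (intro tendsto_Lim tendsto_eventually) auto
qed

lemma has_vp_integral_cmult:
  assumes "has_vp_integral f q"
  shows "has_vp_integral (\<lambda>z. c * f z) (c * q)"
  using assms unfolding has_vp_integral_def
proof (rule eventually_mono)
  fix \<epsilon>
  let ?has = "\<lambda>g a r. ((\<lambda>z. g z / (2 * of_real pi * \<i> * z)) has_contour_integral a) (circlepath 0 r)"
  assume "\<exists>a b. ?has f a (1 - \<epsilon>) \<and> ?has f b (1 + \<epsilon>) \<and> (a + b) / 2 = q"
  then obtain a b where ab: "?has f a (1 - \<epsilon>)" "?has f b (1 + \<epsilon>)" "(a + b) / 2 = q" by blast
  have "?has (\<lambda>z. c * f z) (c * a) (1 - \<epsilon>)" "?has (\<lambda>z. c * f z) (c * b) (1 + \<epsilon>)"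
    using has_contour_integral_lmul[OF ab(1), of c] has_contour_integral_lmul[OF ab(2), of c] by simp_all
  moreover have "(c * a + c * b) / 2 = c * q" using ab(3) by (simp add: distrib_left[symmetric])
  ultimately show "\<exists>a b. ?has (\<lambda>z. c * f z) a (1 - \<epsilon>) \<and> ?has (\<lambda>z. c * f z) b (1 + \<epsilon>) \<and> (a + b) / 2 = c * q"
    by blast
qed

lemma vertex_factor_has_rational_vp_integral:
  "\<exists>q\<in>\<rat>. has_vp_integral (vertex_factor p l) q"
proof -
  obtain a where a: "a \<in> \<rat>" "\<forall>r\<in>{0<..<1}. circle_mean r (vertex_factor p l) = a"
    using circle_mean_vertex_factor_inside by blast
  obtain b where b: "b \<in> \<rat>" "\<forall>r>1. circle_mean r (vertex_factor p l) = b"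
    using circle_mean_vertex_factor_outside by blast
  let ?f = "\<lambda>z. vertex_factor p l z / (2 * of_real pi * \<i> * z)"
  have "(?f has_contour_integral a) (circlepath 0 (1 - \<epsilon>)) \<and> (?f has_contour_integral b) (circlepath 0 (1 + \<epsilon>))"
    if "0 < \<epsilon>" "\<epsilon> < 1" for \<epsilon>
    using that a(2)[rule_format, of "1 - \<epsilon>"] b(2)[rule_format, of "1 + \<epsilon>"]
      vertex_factor_integrable[of "1 - \<epsilon>" p l] vertex_factor_integrable[of "1 + \<epsilon>" p l]
    by (auto simp: circle_mean_def dest!: has_contour_integral_integral)
  moreover have "\<forall>\<^sub>F \<epsilon> in at_right 0. 0 < \<epsilon> \<and> \<epsilon> < (1 :: real)"
    by (auto simp: eventually_at_right_field intro!: exI[of _ 1])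
  ultimately have "has_vp_integral (vertex_factor p l) ((a + b) / 2)"
    unfolding has_vp_integral_def by (auto elim!: eventually_mono)
  thus ?thesis using a b by (intro bexI[of _ "(a + b) / 2"]) auto
qed

text \<open>The integration of one variable leaves a constant factor, which \<open>c\<close> collects in the
induction.\<close>

lemma vp_iterated_prod:
  assumes "\<And>i. i < n \<Longrightarrow> has_vp_integral (f i) (q i)"
  shows "vp_iterated n (\<lambda>z. c * (\<Prod>i<n. f i (z i))) z = c * (\<Prod>i<n. q i)"
  using assms
proof (induction n arbitrary: c)
  case (Suc n)
  have "vp_integral (\<lambda>u. c * (\<Prod>i<Suc n. f i ((z'(n := u)) i))) = c * q n * (\<Prod>i<n. f i (z' i))" for z'
  proof -
    have "(\<lambda>u. c * (\<Prod>i<Suc n. f i ((z'(n := u)) i))) = (\<lambda>u. c * (\<Prod>i<n. f i (z' i)) * f n u)"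
    proof
      fix u
      have "(\<Prod>i<n. f i ((z'(n := u)) i)) = (\<Prod>i<n. f i (z' i))" by (intro prod.cong) auto
      thus "c * (\<Prod>i<Suc n. f i ((z'(n := u)) i)) = c * (\<Prod>i<n. f i (z' i)) * f n u" by simp
    qed
    moreover have "has_vp_integral \<dots> (c * (\<Prod>i<n. f i (z' i)) * q n)"
      using Suc.prems by (intro has_vp_integral_cmult) auto
    ultimately show ?thesis using vp_integral_unique by (simp add: mult_ac)
  qed
  hence "vp_iterated (Suc n) (\<lambda>z. c * (\<Prod>i<Suc n. f i (z i))) z =
      vp_iterated n (\<lambda>z. c * q n * (\<Prod>i<n. f i (z i))) z"
    by (simp only: vp_iterated.simps)
  also have "\<dots> = c * q n * (\<Prod>i<n. q i)" using Suc by simp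
  finally show ?case by (simp add: mult_ac)
qed simp

theorem Zhat_coeff_rational: "Zhat_coeff \<Gamma> l \<in> \<rat>"
proof -
  let ?n = "nverts \<Gamma>" and ?f = "\<lambda>i. vertex_factor (2 - int (deg \<Gamma> i)) (l $ i)"
  have "\<forall>i. \<exists>q. q \<in> \<rat> \<and> has_vp_integral (?f i) q"
    using vertex_factor_has_rational_vp_integral by blast
  then obtain q where q: "\<And>i. q i \<in> \<rat>" "\<And>i. has_vp_integral (?f i) (q i)" by metis
  have "Zhat_integrand \<Gamma> l = (\<lambda>z. 1 * (\<Prod>i<?n. ?f i (z i)))"
    by (simp add: Zhat_integrand_def vertex_factor_def prod.distrib fun_eq_iff)
  hence "vp_iterated ?n (Zhat_integrand \<Gamma> l) z = (\<Prod>i<?n. q i)" for z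
    using vp_iterated_prod[of ?n ?f q 1] q(2) by simp
  thus ?thesis using q(1) by (auto simp: Zhat_coeff_def intro!: Rats_mult Rats_power Rats_prod)
qed

section \<open>Definite unimodular forms\<close>

lemma mult_mat_smult_vec:
  fixes A :: "'a :: comm_semiring_0 mat"
  assumes "A \<in> carrier_mat nr nc" "v \<in> carrier_vec nc"
  shows "A *\<^sub>v (k \<cdot>\<^sub>v v) = k \<cdot>\<^sub>v (A *\<^sub>v v)"
  using assms by (intro eq_vecI) auto

lemma smult_mat_mult_vec:
  fixes A :: "'a :: comm_semiring_0 mat"
  assumes "A \<in> carrier_mat nr nc" "v \<in> carrier_vec nc"
  shows "(k \<cdot>\<^sub>m A) *\<^sub>v v = k \<cdot>\<^sub>v (A *\<^sub>v v)"
  using assms by (intro eq_vecI) (auto simp: scalar_prod_def sum_distrib_left mult.assoc)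

lemma of_int_scalar_prod:
  assumes "dim_vec v = dim_vec w"
  shows "(of_int (v \<bullet> w) :: 'a :: ring_1) = map_vec of_int v \<bullet> map_vec of_int w"
  using assms by (simp add: scalar_prod_def)

definition mat_form :: "int mat \<Rightarrow> int vec \<Rightarrow> int vec \<Rightarrow> int" where
  "mat_form M x y = (M *\<^sub>v x) \<bullet> y"

context
  fixes M :: "int mat" and n :: nat
  assumes M: "M \<in> carrier_mat n n" and MT: "M\<^sup>T = M"
begin

lemma mat_form_sym:
  assumes "x \<in> carrier_vec n" "y \<in> carrier_vec n"
  shows "mat_form M x y = mat_form M y x"
proof -
  have "mat_form M x y = (M\<^sup>T *\<^sub>v x) \<bullet> y" by (simp add: mat_form_def MT)
  also have "\<dots> = x \<bullet> (M *\<^sub>v y)" by (rule transpose_vec_mult_scalar[OF M assms(2,1), symmetric, THEN sym])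
  also have "\<dots> = mat_form M y x" unfolding mat_form_def
    using assms M by (intro comm_scalar_prod) auto
  finally show ?thesis .
qed

lemma mat_form_add_left:
  assumes "x \<in> carrier_vec n" "y \<in> carrier_vec n" "z \<in> carrier_vec n"
  shows "mat_form M (x + y) z = mat_form M x z + mat_form M y z"
  unfolding mat_form_def using assms M
  by (simp add: mult_add_distrib_mat_vec[OF M] add_scalar_prod_distrib[of _ n])

lemma mat_form_diff_left:
  assumes "x \<in> carrier_vec n" "y \<in> carrier_vec n" "z \<in> carrier_vec n"
  shows "mat_form M (x - y) z = mat_form M x z - mat_form M y z"
  unfolding mat_form_def using assms M
  by (simp add: mult_minus_distrib_mat_vec[OF M] minus_scalar_prod_distrib[of _ n])

lemma mat_form_smult_left:
  assumes "x \<in> carrier_vec n" "z \<in> carrier_vec n"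
  shows "mat_form M (k \<cdot>\<^sub>v x) z = k * mat_form M x z"
  unfolding mat_form_def using assms M by (simp add: mult_mat_smult_vec[OF M])

lemma mat_form_add_right:
  assumes "x \<in> carrier_vec n" "y \<in> carrier_vec n" "z \<in> carrier_vec n"
  shows "mat_form M z (x + y) = mat_form M z x + mat_form M z y"
  using assms by (simp add: mat_form_sym[of z] mat_form_add_left)

lemma mat_form_diff_right:
  assumes "x \<in> carrier_vec n" "y \<in> carrier_vec n" "z \<in> carrier_vec n"
  shows "mat_form M z (x - y) = mat_form M z x - mat_form M z y"
  using assms by (simp add: mat_form_sym[of z] mat_form_diff_left)

lemma mat_form_smult_right:
  assumes "x \<in> carrier_vec n" "z \<in> carrier_vec n"
  shows "mat_form M z (k \<cdot>\<^sub>v x) = k * mat_form M z x"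
  using assms by (simp add: mat_form_sym[of z] mat_form_smult_left)

lemmas mat_form_bilinear = mat_form_add_left mat_form_diff_left mat_form_smult_left
  mat_form_add_right mat_form_diff_right mat_form_smult_right

lemma unimodular_solvable:
  assumes "is_unit (Determinant.det M)" "l \<in> carrier_vec n"
  obtains y where "y \<in> carrier_vec n" "M *\<^sub>v y = l"
proof -
  let ?d = "Determinant.det M"
  have d: "?d * ?d = 1" using assms(1) by (auto simp: abs_if split: if_splits)
  note adj = adj_mat[OF M]
  have "M *\<^sub>v (?d \<cdot>\<^sub>v (adj_mat M *\<^sub>v l)) = ?d \<cdot>\<^sub>v ((M * adj_mat M) *\<^sub>v l)"
    using M adj(1) assms(2) by (simp add: mult_mat_smult_vec[OF M] assoc_mult_mat_vec[OF M adj(1)])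
  also have "\<dots> = ?d \<cdot>\<^sub>v (?d \<cdot>\<^sub>v l)"
    unfolding adj(2) using assms(2) by (simp add: smult_mat_mult_vec[of _ n n])
  also have "\<dots> = l" using assms(2) by (simp add: smult_smult_assoc d)
  finally have "M *\<^sub>v (?d \<cdot>\<^sub>v (adj_mat M *\<^sub>v l)) = l" .
  moreover have "?d \<cdot>\<^sub>v (adj_mat M *\<^sub>v l) \<in> carrier_vec n"
    using mult_mat_vec_carrier[OF adj(1) assms(2)] by simp
  ultimately show ?thesis by (rule that[rotated])
qed

context
  assumes neg: "\<And>x. x \<in> carrier_vec n \<Longrightarrow> x \<noteq> 0\<^sub>v n \<Longrightarrow> mat_form M x x < 0"
begin

lemma mat_form_nonpos: "x \<in> carrier_vec n \<Longrightarrow> mat_form M x x \<le> 0"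
  using neg[of x] M by (cases "x = 0\<^sub>v n") (auto simp: mat_form_def)

text \<open>The form \<open>B\<close> is nonpositive at \<open>B(b,b) y - B(b,y) b\<close>, an integral vector proportional to
the component of \<open>y\<close> orthogonal to \<open>b\<close>.\<close>

lemma mat_form_Cauchy_Schwarz:
  assumes "b \<in> carrier_vec n" "y \<in> carrier_vec n"
  shows "(mat_form M b y)\<^sup>2 \<le> mat_form M b b * mat_form M y y"
proof (cases "b = 0\<^sub>v n")
  case True
  have "M *\<^sub>v 0\<^sub>v n = 0\<^sub>v n" using M by (intro eq_vecI) auto
  thus ?thesis using True assms by (simp add: mat_form_def)
next
  case False
  define s where "s = mat_form M b b"
  define t where "t = mat_form M b y"
  define q where "q = mat_form M y y"
  have s: "s < 0" using neg False assms by (simp add: s_def)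
  let ?z = "s \<cdot>\<^sub>v y - t \<cdot>\<^sub>v b"
  have "mat_form M ?z ?z = s * (s * q - t\<^sup>2)"
    using assms by (simp add: mat_form_bilinear mat_form_sym[of y b] s_def t_def q_def
        algebra_simps power2_eq_square)
  hence "s * (s * q - t\<^sup>2) \<le> 0" using mat_form_nonpos[of ?z] assms by simp
  hence "s * q - t\<^sup>2 \<ge> 0" using s by (simp add: mult_le_0_iff)
  thus ?thesis by (simp add: s_def t_def q_def)
qed

text \<open>The coordinate \<open>y\<^sub>i\<close> is the pairing of \<open>y\<close> with the integral preimage of the \<open>i\<close>-th unit
vector, so the Cauchy-Schwarz inequality bounds it in terms of \<open>c\<close>.\<close>

lemma finite_mat_form_eq:
  assumes unit: "is_unit (Determinant.det M)"
  shows "finite {y \<in> carrier_vec n. mat_form M y y = c}"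
proof -
  have "\<exists>b. b \<in> carrier_vec n \<and> M *\<^sub>v b = unit_vec n i" for i
    using unimodular_solvable[OF unit, of "unit_vec n i"] by auto
  then obtain b where b: "\<And>i. b i \<in> carrier_vec n" "\<And>i. M *\<^sub>v b i = unit_vec n i" by metis
  define B where "B i = mat_form M (b i) (b i) * c" for i
  have bound: "y $ i \<in> {- B i..B i}" if y: "y \<in> carrier_vec n" "mat_form M y y = c" and i: "i < n" for y i
  proof -
    have "mat_form M (b i) y = y $ i" using y i by (simp add: mat_form_def b)
    hence "(y $ i)\<^sup>2 \<le> B i" using mat_form_Cauchy_Schwarz[OF b(1) y(1), of i] y(2) by (simp add: B_def)
    moreover have "\<bar>y $ i\<bar> \<le> (y $ i)\<^sup>2"
      using mult_left_mono[of 1 "\<bar>y $ i\<bar>" "\<bar>y $ i\<bar>"]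
      by (cases "y $ i = 0") (auto simp: power2_eq_square)
    ultimately show ?thesis by auto
  qed
  have "{y \<in> carrier_vec n. mat_form M y y = c} \<subseteq> Matrix.vec n ` (\<Pi>\<^sub>E i\<in>{..<n}. {- B i..B i})"
  proof
    fix y assume "y \<in> {y \<in> carrier_vec n. mat_form M y y = c}"
    hence y: "y \<in> carrier_vec n" "mat_form M y y = c" by auto
    have "y = Matrix.vec n (restrict (($) y) {..<n})" using y by (intro eq_vecI) auto
    thus "y \<in> Matrix.vec n ` (\<Pi>\<^sub>E i\<in>{..<n}. {- B i..B i})"
      using bound[OF y] by (intro image_eqI[of _ _ "restrict (($) y) {..<n}"]) auto
  qed
  thus ?thesis by (rule finite_subset) (auto intro: finite_PiE)
qed

end
end

section \<open>The inverse linking form on the image of the linking matrix\<close>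

lemma mat_form_linking_matrix_neg:
  assumes "negative_definite \<Gamma>" "x \<in> carrier_vec (nverts \<Gamma>)" "x \<noteq> 0\<^sub>v (nverts \<Gamma>)"
  shows "mat_form (linking_matrix \<Gamma>) x x < 0"
proof -
  let ?x = "map_vec real_of_int x"
  have "?x \<noteq> 0\<^sub>v (nverts \<Gamma>)"
    using assms(2,3) by (metis of_int_hom.vec_hom_zero_iff carrier_vecD)
  hence "?x \<bullet> (linking_matrix_real \<Gamma> *\<^sub>v ?x) < 0"
    using assms by (simp add: negative_definite_def)
  also have "linking_matrix_real \<Gamma> *\<^sub>v ?x = map_vec real_of_int (linking_matrix \<Gamma> *\<^sub>v x)"
    unfolding linking_matrix_real_def
    by (rule of_int_hom.mult_mat_vec_hom[symmetric, OF linking_matrix_carrier(1) assms(2)])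
  also have "?x \<bullet> \<dots> = real_of_int (x \<bullet> (linking_matrix \<Gamma> *\<^sub>v x))"
    by (rule of_int_scalar_prod[symmetric])
      (use assms(2) carrier_matD(1)[OF linking_matrix_carrier(1)] in auto)
  also have "x \<bullet> (linking_matrix \<Gamma> *\<^sub>v x) = mat_form (linking_matrix \<Gamma>) x x"
    unfolding mat_form_def
    by (rule comm_scalar_prod[of _ "nverts \<Gamma>"])
      (use assms(2) mult_mat_vec_carrier[OF linking_matrix_carrier(1)] in auto)
  finally show ?thesis by simp
qed

lemma inv_form_linking_image:
  assumes det: "Determinant.det (linking_matrix \<Gamma>) \<noteq> 0" and y: "y \<in> carrier_vec (nverts \<Gamma>)"
  shows "inv_form \<Gamma> (linking_matrix \<Gamma> *\<^sub>v y) = real_of_int (mat_form (linking_matrix \<Gamma>) y y)"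
proof -
  let ?n = "nverts \<Gamma>" and ?R = "linking_matrix_real \<Gamma>" and ?M = "linking_matrix \<Gamma>"
  have "Determinant.det ?R \<noteq> 0"
    using det unfolding linking_matrix_real_def of_int_hom.hom_det by simp
  hence "?R \<in> Units (ring_mat TYPE(real) ?n ())"
    by (rule det_non_zero_imp_unit[OF linking_matrix_carrier(2)])
  then obtain B where B: "mat_inverse ?R = Some B"
    using mat_inverse(1)[of ?R ?n "()"] by (cases "mat_inverse ?R") auto
  have BR: "B * ?R = 1\<^sub>m ?n" "B \<in> carrier_mat ?n ?n"
    using mat_inverse(2)[OF linking_matrix_carrier(2) B] by auto
  let ?y = "map_vec real_of_int y"
  have hom: "map_vec real_of_int (?M *\<^sub>v y) = ?R *\<^sub>v ?y"
    unfolding linking_matrix_real_def by (rule of_int_hom.mult_mat_vec_hom[OF linking_matrix_carrier(1) y])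
  have "B *\<^sub>v (?R *\<^sub>v ?y) = ?y"
    using assoc_mult_mat_vec[OF BR(2) linking_matrix_carrier(2), of ?y] y by (simp add: BR)
  hence "inv_form \<Gamma> (?M *\<^sub>v y) = map_vec real_of_int (?M *\<^sub>v y) \<bullet> ?y"
    unfolding inv_form_def B hom by simp
  also have "\<dots> = real_of_int ((?M *\<^sub>v y) \<bullet> y)"
    by (rule of_int_scalar_prod[symmetric])
      (use y carrier_matD(1)[OF linking_matrix_carrier(1)] in auto)
  finally show ?thesis by (simp add: mat_form_def)
qed

lemma spinc_coset_carrier:
  assumes "a \<in> carrier_vec (nverts \<Gamma>)"
  shows "spinc_coset \<Gamma> a \<subseteq> carrier_vec (nverts \<Gamma>)"
  using assms mult_mat_vec_carrier[OF linking_matrix_carrier(1)] by (auto simp: spinc_coset_def)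

section \<open>\<open>\<Delta>\<close> is an exponent\<close>

lemma det_linking_matrix_unit:
  "integral_homology_sphere \<Gamma> \<Longrightarrow> is_unit (Determinant.det (linking_matrix \<Gamma>))"
  by (auto simp: integral_homology_sphere_def)

context
  fixes \<Gamma> :: wgraph and a :: "int vec"
  assumes tree: "weighted_tree \<Gamma>" and nd: "negative_definite \<Gamma>" and ihs: "integral_homology_sphere \<Gamma>"
    and a: "a \<in> carrier_vec (nverts \<Gamma>)"
begin

lemma spinc_coset_cases:
  assumes "l \<in> spinc_coset \<Gamma> a"
  obtains y where "y \<in> carrier_vec (nverts \<Gamma>)" "l = linking_matrix \<Gamma> *\<^sub>v y"
    "inv_form \<Gamma> l = real_of_int (mat_form (linking_matrix \<Gamma>) y y)"
proof -
  have "l \<in> carrier_vec (nverts \<Gamma>)" using assms spinc_coset_carrier[OF a] by blast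
  then obtain y where y: "y \<in> carrier_vec (nverts \<Gamma>)" "linking_matrix \<Gamma> *\<^sub>v y = l"
    using unimodular_solvable[OF linking_matrix_carrier(1) linking_matrix_symmetric(1)[OF tree] det_linking_matrix_unit[OF ihs]] by blast
  moreover have "Determinant.det (linking_matrix \<Gamma>) \<noteq> 0" using det_linking_matrix_unit[OF ihs] by auto
  ultimately show ?thesis using that inv_form_linking_image by blast
qed

lemma finite_spinc_coset_exponent:
  "finite {l \<in> spinc_coset \<Gamma> a. q_exponent \<Gamma> l = e}"
proof -
  let ?M = "linking_matrix \<Gamma>" and ?r = "4 * (shift_exponent \<Gamma> - e)"
  have "{l \<in> spinc_coset \<Gamma> a. q_exponent \<Gamma> l = e} \<subseteq>
      (*\<^sub>v) ?M ` {y \<in> carrier_vec (nverts \<Gamma>). mat_form ?M y y = \<lfloor>?r\<rfloor>}"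
  proof
    fix l assume "l \<in> {l \<in> spinc_coset \<Gamma> a. q_exponent \<Gamma> l = e}"
    hence l: "l \<in> spinc_coset \<Gamma> a" and e: "q_exponent \<Gamma> l = e" by auto
    obtain y where y: "y \<in> carrier_vec (nverts \<Gamma>)" "l = ?M *\<^sub>v y" "inv_form \<Gamma> l = real_of_int (mat_form ?M y y)"
      using spinc_coset_cases[OF l] .
    have "?r = real_of_int (mat_form ?M y y)" using e y(3) by (simp add: q_exponent_def)
    hence "\<lfloor>?r\<rfloor> = mat_form ?M y y" by simp
    thus "l \<in> (*\<^sub>v) ?M ` {y \<in> carrier_vec (nverts \<Gamma>). mat_form ?M y y = \<lfloor>?r\<rfloor>}" using y by auto
  qed
  moreover have "finite {y \<in> carrier_vec (nverts \<Gamma>). mat_form ?M y y = \<lfloor>?r\<rfloor>}"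
    using mat_form_linking_matrix_neg[OF nd] det_linking_matrix_unit[OF ihs]
    by (intro finite_mat_form_eq linking_matrix_symmetric(1)[OF tree]) auto
  ultimately show ?thesis by (rule finite_subset[OF _ finite_imageI])
qed

lemma Zhat_rational: "Zhat \<Gamma> a e \<in> \<rat>"
  unfolding Zhat_def q_series_def infsum_finite[OF finite_spinc_coset_exponent]
  using Zhat_coeff_rational by auto

text \<open>Choose one element of the coset for each power of \<open>q\<close> with nonzero coefficient, and let it
carry the whole coefficient.\<close>

lemma reduced_indexing_set_exists: "\<exists>I. reduced_indexing_set \<Gamma> a I"
proof -
  let ?Z = "Zhat \<Gamma> a"
  have "\<exists>l. l \<in> spinc_coset \<Gamma> a \<and> q_exponent \<Gamma> l = e" if "?Z e \<noteq> 0" for e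
  proof (rule ccontr)
    assume "\<not> ?thesis"
    hence "{l \<in> spinc_coset \<Gamma> a. q_exponent \<Gamma> l = e} = {}" by auto
    hence "?Z e = 0" unfolding Zhat_def q_series_def by (simp only: infsum_empty)
    thus False using that by simp
  qed
  then obtain g where g: "\<And>e. ?Z e \<noteq> 0 \<Longrightarrow> g e \<in> spinc_coset \<Gamma> a"
    "\<And>e. ?Z e \<noteq> 0 \<Longrightarrow> q_exponent \<Gamma> (g e) = e" by metis
  define I where "I = g ` {e. ?Z e \<noteq> 0}"
  define c where "c l = ?Z (q_exponent \<Gamma> l)" for l
  have "I \<subseteq> spinc_coset \<Gamma> a" using g by (auto simp: I_def)
  moreover have "inj_on (q_exponent \<Gamma>) I" using g by (auto simp: I_def inj_on_def)
  moreover have "\<forall>l\<in>I. c l \<in> \<rat> - {0}" using g Zhat_rational by (auto simp: I_def c_def)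
  moreover have "?Z e = q_series \<Gamma> I c e" for e
  proof (cases "?Z e = 0")
    case True
    hence "{l \<in> I. q_exponent \<Gamma> l = e} = {}" using g by (auto simp: I_def)
    thus ?thesis using True by (simp only: q_series_def infsum_empty)
  next
    case False
    hence "{l \<in> I. q_exponent \<Gamma> l = e} = {g e}" using g by (auto simp: I_def)
    thus ?thesis using False g by (simp add: q_series_def c_def)
  qed
  ultimately show ?thesis unfolding reduced_indexing_set_def by blast
qed

text \<open>The pairings of elements of the coset with themselves are nonpositive integers, so a maximum over the
nonempty reduced indexing set exists.\<close>

lemma Delta_eq_q_exponent:
  assumes "Zhat \<Gamma> a \<noteq> (\<lambda>_. 0)"
  shows "\<exists>l\<in>spinc_coset \<Gamma> a. Delta \<Gamma> a = q_exponent \<Gamma> l"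
proof -
  define I where "I = (SOME I. reduced_indexing_set \<Gamma> a I)"
  have I: "reduced_indexing_set \<Gamma> a I"
    unfolding I_def using reduced_indexing_set_exists by (rule someI_ex)
  have "I \<noteq> {}"
  proof
    assume "I = {}"
    hence "Zhat \<Gamma> a = (\<lambda>_. 0)"
      using I by (auto simp: reduced_indexing_set_def q_series_def)
    thus False using assms by simp
  qed
  then obtain l1 where "l1 \<in> I" by auto
  have sub: "I \<subseteq> spinc_coset \<Gamma> a" using I by (simp add: reduced_indexing_set_def)
  have int: "\<exists>k. inv_form \<Gamma> l = - real k" if "l \<in> I" for l
  proof -
    have "l \<in> spinc_coset \<Gamma> a" using that sub by blast
    then obtain y where y: "y \<in> carrier_vec (nverts \<Gamma>)"
      "inv_form \<Gamma> l = real_of_int (mat_form (linking_matrix \<Gamma>) y y)"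
      using spinc_coset_cases by blast
    have "mat_form (linking_matrix \<Gamma>) y y \<le> 0"
      by (rule mat_form_nonpos[OF linking_matrix_carrier(1) linking_matrix_symmetric(1)[OF tree] _ y(1)])
        (rule mat_form_linking_matrix_neg[OF nd])
    thus ?thesis using y(2) by (intro exI[of _ "nat (- mat_form (linking_matrix \<Gamma>) y y)"]) simp
  qed
  then obtain k where k: "\<And>l. l \<in> I \<Longrightarrow> inv_form \<Gamma> l = - real (k l)" by metis
  obtain l0 where l0: "l0 \<in> I" "\<And>l. l \<in> I \<Longrightarrow> k l0 \<le> k l"
    using \<open>l1 \<in> I\<close> ex_has_least_nat[of "\<lambda>l. l \<in> I" l1 k] by blast
  have "(GREATEST m. m \<in> (\<lambda>l. inv_form \<Gamma> l / 4) ` I) = inv_form \<Gamma> l0 / 4"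
    by (rule Greatest_equality) (use l0 in \<open>auto simp: k\<close>)
  hence "Delta \<Gamma> a = q_exponent \<Gamma> l0"
    by (simp add: Delta_def I_def[symmetric] q_exponent_def)
  thus ?thesis using l0 sub by blast
qed

end

section \<open>The exponents modulo 1\<close>

lemma linking_matrix_ones:
  assumes "weighted_tree \<Gamma>"
  shows "linking_matrix \<Gamma> *\<^sub>v Matrix.vec (nverts \<Gamma>) (\<lambda>_. 1) =
    Matrix.vec (nverts \<Gamma>) (\<lambda>i. linking_matrix \<Gamma> $$ (i, i)) + deg_vec \<Gamma>"
proof (rule eq_vecI)
  let ?n = "nverts \<Gamma>"
  fix i assume "i < dim_vec (Matrix.vec ?n (\<lambda>i. linking_matrix \<Gamma> $$ (i, i)) + deg_vec \<Gamma>)"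
  hence i: "i < ?n" by (simp add: deg_vec_def)
  have E: "edges \<Gamma> \<subseteq> {..<?n} \<times> {..<?n}" "(i, i) \<notin> edges \<Gamma>"
    using assms by (auto simp: weighted_tree_def irrefl_def)
  have "(linking_matrix \<Gamma> *\<^sub>v Matrix.vec ?n (\<lambda>_. 1)) $ i = (\<Sum>j<?n. linking_matrix \<Gamma> $$ (i, j))"
    using i by (simp add: scalar_prod_def lessThan_atLeast0 linking_matrix_def)
  also have "\<dots> = weight \<Gamma> i + (\<Sum>j\<in>{..<?n} - {i}. linking_matrix \<Gamma> $$ (i, j))"
    using i by (subst sum.remove[of _ i]) (auto simp: linking_matrix_def)
  also have "(\<Sum>j\<in>{..<?n} - {i}. linking_matrix \<Gamma> $$ (i, j)) = (\<Sum>j\<in>{u. (i, u) \<in> edges \<Gamma>}. 1)"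
    using i E by (intro sum.mono_neutral_cong_right) (auto simp: linking_matrix_def)
  also have "\<dots> = int (deg \<Gamma> i)" by (simp add: deg_def)
  finally show "(linking_matrix \<Gamma> *\<^sub>v Matrix.vec ?n (\<lambda>_. 1)) $ i =
      (Matrix.vec ?n (\<lambda>i. linking_matrix \<Gamma> $$ (i, i)) + deg_vec \<Gamma>) $ i"
    using i by (simp add: deg_vec_def linking_matrix_def)
qed (simp add: deg_vec_def linking_matrix_def)

text \<open>The computation described at the beginning. All exponents are multiplied by 4 and compared
modulo 4.\<close>

lemma q_exponent_spinc_coset_deg_vec:
  assumes tree: "weighted_tree \<Gamma>" and nd: "negative_definite \<Gamma>" and ihs: "integral_homology_sphere \<Gamma>"
    and l: "l \<in> spinc_coset \<Gamma> (deg_vec \<Gamma>)"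
  shows "q_exponent \<Gamma> l - 1/2 \<in> \<int>"
proof -
  define n where "n = nverts \<Gamma>"
  define M where "M = linking_matrix \<Gamma>"
  define u where "u = Matrix.vec n (\<lambda>_. 1 :: int)"
  define w where "w = Matrix.vec n (\<lambda>i. M $$ (i, i))"
  let ?d = "deg_vec \<Gamma>" and ?B = "mat_form M" and ?tr = "mat_trace M"
  have M: "M \<in> carrier_mat n n" and MT: "M\<^sup>T = M"
    using linking_matrix_symmetric[OF tree] by (auto simp: M_def n_def)
  have uC: "u \<in> carrier_vec n" and wC: "w \<in> carrier_vec n" and dC: "?d \<in> carrier_vec n"
    by (auto simp: u_def w_def n_def deg_vec_def)
  have unit: "is_unit (Determinant.det M)" using det_linking_matrix_unit[OF ihs] by (simp add: M_def)
  have Mu: "M *\<^sub>v u = w + ?d" using linking_matrix_ones[OF tree] by (simp add: M_def u_def w_def n_def)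
  obtain y where y: "y \<in> carrier_vec n" "M *\<^sub>v y = w" using unimodular_solvable[OF M MT unit wC] .
  obtain x where x: "x \<in> carrier_vec n" "l = 2 \<cdot>\<^sub>v (M *\<^sub>v x) + ?d"
    using l by (auto simp: spinc_coset_def M_def n_def)
  \<comment> \<open>The integral preimage of \<open>\<delta>\<close>.\<close>
  define t where "t = u - y"
  have tC: "t \<in> carrier_vec n" using uC y by (simp add: t_def)
  have "M *\<^sub>v t = w + ?d - w"
    unfolding t_def using uC y by (simp add: mult_minus_distrib_mat_vec[OF M] Mu)
  also have "\<dots> = ?d" using wC dC by (intro eq_vecI) auto
  finally have Mt: "M *\<^sub>v t = ?d" .
  have lM: "l = M *\<^sub>v (2 \<cdot>\<^sub>v x + t)"
    unfolding x(2) using x(1) tC by (simp add: mult_add_distrib_mat_vec[OF M] mult_mat_smult_vec[OF M] Mt)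
  have inv: "inv_form \<Gamma> l = real_of_int (?B (2 \<cdot>\<^sub>v x + t) (2 \<cdot>\<^sub>v x + t))"
    unfolding lM M_def using unit x(1) tC
    by (intro inv_form_linking_image) (auto simp: M_def n_def)
  have "?B (2 \<cdot>\<^sub>v x + t) (2 \<cdot>\<^sub>v x + t) = 4 * (?B x x + ?B x t) + ?B t t"
    using x(1) tC by (simp add: mat_form_bilinear[OF M MT] mat_form_sym[OF M MT, of t x])
  also have "?B t t = ?B u u - 2 * ?B y u + ?B y y"
    using uC y(1) by (simp add: t_def mat_form_bilinear[OF M MT] mat_form_sym[OF M MT, of u y])
  also have wu: "?B y u = ?tr"
    using M by (simp add: mat_form_def y(2) w_def u_def scalar_prod_def mat_trace_def lessThan_atLeast0)
  also have "?B u u = ?tr + 2 * int n - 2"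
  proof -
    have "?B u u = w \<bullet> u + ?d \<bullet> u"
      unfolding mat_form_def Mu using wC dC uC by (rule add_scalar_prod_distrib)
    also have "w \<bullet> u = ?tr" using wu by (simp add: mat_form_def y(2))
    also have "?d \<bullet> u = int (\<Sum>i<n. deg \<Gamma> i)"
      by (simp add: deg_vec_def u_def n_def scalar_prod_def lessThan_atLeast0)
    also have "\<dots> = 2 * int n - 2"
      using arg_cong[OF weighted_tree_sum_deg[OF tree], of int] unfolding n_def of_nat_add of_nat_mult by simp
    finally show ?thesis by simp
  qed
  finally have form: "?B (2 \<cdot>\<^sub>v x + t) (2 \<cdot>\<^sub>v x + t) =
      4 * (?B x x + ?B x t) + (?tr + 2 * int n - 2 - 2 * ?tr + ?B y y)" by simp
  have "odd (Determinant.det M)" using unit by (metis dvd_trans odd_one)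
  hence "[?B y y = int n + Determinant.det M - 1] (mod 4)"
    unfolding mat_form_def using y
    by (intro characteristic_square_mod_4 M MT) (auto simp: w_def)
  also have "Determinant.det M = (-1) ^ n"
    using det_linking_matrix_neg_def[OF tree nd ihs] by (simp add: M_def n_def)
  also have "[int n + (-1) ^ n - 1 = - int n] (mod 4)"
    by (cases "even n") (auto simp: cong_iff_dvd_diff elim!: evenE oddE)
  finally obtain k where k: "?B y y = - int n + 4 * k"
    by (metis cong_iff_lin cong_sym)
  have "4 * (q_exponent \<Gamma> l - 1/2) = real_of_int (- 3 * int n - ?tr - ?B (2 \<cdot>\<^sub>v x + t) (2 \<cdot>\<^sub>v x + t) - 2)"
    unfolding q_exponent_def shift_exponent_def inv signature_neg_def[OF tree nd]
    by (simp add: M_def n_def field_simps)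
  also have "\<dots> = 4 * real_of_int (- int n - k - ?B x x - ?B x t)"
    unfolding form k by simp
  finally have "q_exponent \<Gamma> l - 1/2 = real_of_int (- int n - k - ?B x x - ?B x t)" by simp
  thus ?thesis by (metis Ints_of_int)
qed

theorem proposition5p5:
  fixes \<Gamma> :: wgraph
  assumes "almost_rational \<Gamma>"
    and "negative_definite \<Gamma>"
    and "integral_homology_sphere \<Gamma>"
    and Delta_defined: "Zhat \<Gamma> (deg_vec \<Gamma>) \<noteq> (\<lambda>_. 0)"
  shows "Delta \<Gamma> (deg_vec \<Gamma>) - 1/2 \<in> \<int>"
proof -
  have tree: "weighted_tree \<Gamma>" using assms(1) by (simp add: almost_rational_def)
  have "deg_vec \<Gamma> \<in> carrier_vec (nverts \<Gamma>)" by (simp add: deg_vec_def)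
  then obtain l where "l \<in> spinc_coset \<Gamma> (deg_vec \<Gamma>)" "Delta \<Gamma> (deg_vec \<Gamma>) = q_exponent \<Gamma> l"
    using Delta_eq_q_exponent[OF tree assms(2,3) _ Delta_defined] by blast
  thus ?thesis using q_exponent_spinc_coset_deg_vec[OF tree assms(2,3)] by simp
qed

end
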